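(* Let $A\in\mathbb{R}^{N\times N}$, $C\in\mathbb{R}^{M\times N}$ with $(C,A)$ observable, and let $Q\in\mathbb{R}^{N\times N}$, $R\in\mathbb{R}^{M\times M}$ be symmetric positive definite. Let $\{P_t\}_{t\ge 0}$ be the random Riccati sequence with packet arrival probability $\overline{\gamma}$ and initial condition $P_0\in\mathbb{S}_+^N$, and let $\mu_t^{\overline{\gamma},P_0}$ be the distribution of $P_t$. Then: (1) For each $\overline{\gamma}\in(0,1]$ there exists a unique invariant distribution $\mu^{\overline{\gamma}}$ on $\mathbb{S}_+^N$ such that, for every initial condition $P_0\in\mathbb{S}_+^N$, the sequence $\{P_t\}$ (equivalently the sequence of measures $\{\mu_t^{\overline{\gamma},P_0}\}_{t}$) converges weakly to $\mu^{\overline{\gamma}}$. (2) Let $$\mathcal{S}=\left\{f_{i_1}\circ f_{i_2}\circ\cdots\circ f_{i_s}(P^{\ast})\;\middle|\; s\in\{0,1,2,\dots\},\ i_r\in\{0,1\},\ 1\le r\le s\right\}$$ (for $s=0$ the element is $P^\ast$ itself). If $0<\overline{\gamma}<1$, then $\operatorname{supp}(\mu^{\overline{\gamma}})=\operatorname{cl}(\mathcal{S})$, the topological closure of $\mathcal{S}$ in $\mathbb{S}_+^N$. In particular, $$\mu^{\overline{\gamma}}\left(\{Y\in\mathbb{S}_+^N \mid Y\succeq P^{\ast}\}\right)=1.$$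
   Context: $\mathbb{S}_+^N$ is the set of real symmetric positive semidefinite $N\times N$ matrices with the metric induced by the spectral norm $\|\cdot\|$; $X\preceq Y$ means $Y-X$ is positive semidefinite. Define $f_0,f_1:\mathbb{S}_+^N\to\mathbb{S}_+^N$ by $$f_0(X)=AXA^T+Q,\qquad f_1(X)=AXA^T+Q-AXC^T(CXC^T+R)^{-1}CXA^T .$$ $P^\ast$ is the unique fixed point of $f_1$ in $\mathbb{S}_+^N$ (it exists and is unique under the stated hypotheses). For $\overline{\gamma}\in[0,1]$, let $\{\gamma_t\}_{t\ge0}$ be i.i.d. Bernoulli random variables with $\mathbb{P}(\gamma_t=1)=\overline{\gamma}$; given a deterministic $P_0\in\mathbb{S}_+^N$, the random Riccati sequence is the Markov chain $P_{t+1}=f_{\gamma_t}(P_t)$, $t\ge 0$. An invariant distribution is an invariant probability measure of this Markov chain. The support of a probability measure $\mu$ on a metric space is $\operatorname{supp}(\mu)=\{x\mid\mu(B_\varepsilon(x))>0\ \forall\varepsilon>0\}$, where $B_\varepsilon(x)$ is the open ball of radius $\varepsilon$ centered at $x$. *)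

theory Defs
  imports "HOL-Probability.Probability"
begin

section \<open>Semidefinite matrices and the spectral metric\<close>

definition symmetric_matrix :: "real^'n^'n \<Rightarrow> bool" where
  "symmetric_matrix X \<longleftrightarrow> transpose X = X"

definition pos_semidef :: "real^'n^'n \<Rightarrow> bool" where
  "pos_semidef X \<longleftrightarrow> symmetric_matrix X \<and> (\<forall>v. 0 \<le> v \<bullet> (X *v v))"

definition pos_def :: "real^'n^'n \<Rightarrow> bool" where
  "pos_def X \<longleftrightarrow> symmetric_matrix X \<and> (\<forall>v. v \<noteq> 0 \<longrightarrow> 0 < v \<bullet> (X *v v))"

definition psd_cone :: "(real^'n^'n) set" where
  "psd_cone = {X. pos_semidef X}"

definition loewner_le :: "real^'n^'n \<Rightarrow> real^'n^'n \<Rightarrow> bool" (infix "\<preceq>" 50) where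
  "X \<preceq> Y \<longleftrightarrow> pos_semidef (Y - X)"

text \<open>The library norm on \<open>real^'n^'n\<close> is the Frobenius norm, so the spectral norm is
  introduced separately, as the operator norm induced by the Euclidean norm.\<close>

definition spectral_norm :: "real^'n^'m \<Rightarrow> real" where
  "spectral_norm X = onorm ((*v) X)"

definition spectral_dist :: "real^'n^'n \<Rightarrow> real^'n^'n \<Rightarrow> real" where
  "spectral_dist X Y = spectral_norm (X - Y)"

lemma Metric_space_psd_cone: "Metric_space psd_cone spectral_dist"
proof
  fix X Y Z :: "real^'n^'n"
  have bl: "bounded_linear ((*v) W)" for W :: "real^'n^'n"
    by (rule matrix_vector_mul_bounded_linear)
  show "0 \<le> spectral_dist X Y"
    unfolding spectral_dist_def spectral_norm_def by (rule onorm_pos_le[OF bl])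
  show "spectral_dist X Y = spectral_dist Y X"
  proof -
    have "(*v) (Y - X) = (\<lambda>v. - ((X - Y) *v v))"
      by (auto simp: fun_eq_iff matrix_vector_mult_diff_rdistrib)
    then show ?thesis
      unfolding spectral_dist_def spectral_norm_def by (simp add: onorm_neg)
  qed
  show "spectral_dist X Y = 0 \<longleftrightarrow> X = Y"
  proof -
    have "spectral_dist X Y = 0 \<longleftrightarrow> (\<forall>v. (X - Y) *v v = 0)"
      unfolding spectral_dist_def spectral_norm_def by (rule onorm_eq_0[OF bl])
    also have "\<dots> \<longleftrightarrow> X = Y"
      by (simp add: matrix_vector_mult_diff_rdistrib matrix_eq)
    finally show ?thesis .
  qed
  show "spectral_dist X Z \<le> spectral_dist X Y + spectral_dist Y Z"
  proof -
    have "(*v) (X - Z) = (\<lambda>v. (X - Y) *v v + (Y - Z) *v v)"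
      by (auto simp: fun_eq_iff matrix_vector_mult_diff_rdistrib)
    then show ?thesis
      unfolding spectral_dist_def spectral_norm_def
      by (simp add: onorm_triangle[OF bl bl])
  qed
qed

global_interpretation psd: Metric_space psd_cone spectral_dist
  by (rule Metric_space_psd_cone)


section \<open>Probability measures on the cone\<close>

definition psd_borel :: "(real^'n^'n) measure" where
  "psd_borel = sigma psd_cone {U. openin psd.mtopology U}"

definition psd_support :: "(real^'n^'n) measure \<Rightarrow> (real^'n^'n) set" where
  "psd_support \<mu> = {X \<in> psd_cone. \<forall>\<epsilon>>0. 0 < measure \<mu> (psd.mball X \<epsilon>)}"

definition psd_weak_conv :: "(nat \<Rightarrow> (real^'n^'n) measure) \<Rightarrow> (real^'n^'n) measure \<Rightarrow> bool" where
  "psd_weak_conv \<mu>s \<mu> \<longleftrightarrow>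
     (\<forall>h. continuous_map psd.mtopology euclideanreal h \<and> bounded (h ` psd_cone) \<longrightarrow>
        (\<lambda>t. integral\<^sup>L (\<mu>s t) h) \<longlonglongrightarrow> integral\<^sup>L \<mu> h)"


section \<open>The random Riccati sequence\<close>

primrec matrix_power :: "real^'n^'n \<Rightarrow> nat \<Rightarrow> real^'n^'n" where
  "matrix_power A 0 = mat 1"
| "matrix_power A (Suc k) = A ** matrix_power A k"

text \<open>The observability matrix stacks the blocks \<open>C A\<^sup>k\<close> for \<open>k < N\<close>.
  Its rank is the dimension of the span of all the rows of these blocks
  (cf. \<open>row_rank_def\<close>), and it has to be \<open>N\<close>.\<close>

definition observable :: "real^'n^'m \<Rightarrow> real^'n^'n \<Rightarrow> bool" where
  "observable C A \<longleftrightarrow> dim (\<Union>k<CARD('n). rows (C ** matrix_power A k)) = CARD('n)"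

definition riccati_open :: "real^'n^'n \<Rightarrow> real^'n^'n \<Rightarrow> real^'n^'n \<Rightarrow> real^'n^'n" where
  "riccati_open A Q X = A ** X ** transpose A + Q"

definition riccati_closed ::
    "real^'n^'n \<Rightarrow> real^'n^'m \<Rightarrow> real^'n^'n \<Rightarrow> real^'m^'m \<Rightarrow> real^'n^'n \<Rightarrow> real^'n^'n" where
  "riccati_closed A C Q R X =
     A ** X ** transpose A + Q
     - A ** X ** transpose C ** matrix_inv (C ** X ** transpose C + R) ** C ** X ** transpose A"

text \<open>The index \<open>i \<in> {0, 1}\<close> of \<open>f\<^sub>i\<close> is a Boolean, \<open>True\<close> standing for \<open>1\<close> (packet received).\<close>

definition riccati_map ::
    "real^'n^'n \<Rightarrow> real^'n^'m \<Rightarrow> real^'n^'n \<Rightarrow> real^'m^'m \<Rightarrow> bool \<Rightarrow> real^'n^'n \<Rightarrow> real^'n^'n" where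
  "riccati_map A C Q R i = (if i then riccati_closed A C Q R else riccati_open A Q)"

definition riccati_fixpoint ::
    "real^'n^'n \<Rightarrow> real^'n^'m \<Rightarrow> real^'n^'n \<Rightarrow> real^'m^'m \<Rightarrow> real^'n^'n" where
  "riccati_fixpoint A C Q R = (THE P. P \<in> psd_cone \<and> riccati_closed A C Q R P = P)"

primrec riccati_seq ::
    "real^'n^'n \<Rightarrow> real^'n^'m \<Rightarrow> real^'n^'n \<Rightarrow> real^'m^'m \<Rightarrow> (nat \<Rightarrow> 'w \<Rightarrow> bool) \<Rightarrow>
     real^'n^'n \<Rightarrow> nat \<Rightarrow> 'w \<Rightarrow> real^'n^'n" where
  "riccati_seq A C Q R \<gamma> P0 0 \<omega> = P0"
| "riccati_seq A C Q R \<gamma> P0 (Suc t) \<omega> =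
     riccati_map A C Q R (\<gamma> t \<omega>) (riccati_seq A C Q R \<gamma> P0 t \<omega>)"

definition riccati_kernel ::
    "real^'n^'n \<Rightarrow> real^'n^'m \<Rightarrow> real^'n^'n \<Rightarrow> real^'m^'m \<Rightarrow> real \<Rightarrow>
     real^'n^'n \<Rightarrow> (real^'n^'n) measure" where
  "riccati_kernel A C Q R g X =
     distr (measure_pmf (bernoulli_pmf g)) psd_borel (\<lambda>i. riccati_map A C Q R i X)"

definition riccati_invariant ::
    "real^'n^'n \<Rightarrow> real^'n^'m \<Rightarrow> real^'n^'n \<Rightarrow> real^'m^'m \<Rightarrow> real \<Rightarrow>
     (real^'n^'n) measure \<Rightarrow> bool" where
  "riccati_invariant A C Q R g \<mu> \<longleftrightarrow>
     prob_space \<mu> \<and> sets \<mu> = sets psd_borel \<and>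
     (\<forall>B\<in>sets psd_borel. emeasure \<mu> B = (\<integral>\<^sup>+X. emeasure (riccati_kernel A C Q R g X) B \<partial>\<mu>))"

definition riccati_orbit ::
    "real^'n^'n \<Rightarrow> real^'n^'m \<Rightarrow> real^'n^'n \<Rightarrow> real^'m^'m \<Rightarrow> (real^'n^'n) set" where
  "riccati_orbit A C Q R =
     {foldr (riccati_map A C Q R) is (riccati_fixpoint A C Q R) | is :: bool list. True}"

end

theory Submission
  imports Defs
begin

text \<open>Completing the square gives \<open>v \<bullet> f\<^sub>1(X) v = min\<^sub>u (A\<^sup>Tv - C\<^sup>Tu) \<bullet> X (A\<^sup>Tv - C\<^sup>Tu) + v \<bullet> Qv + u \<bullet> Ru\<close>,
  and \<open>f\<^sub>0\<close> is the same expression at \<open>u = 0\<close>. Hence both maps are monotone, and \<open>X \<preceq> Y \<preceq> (1 + c)X\<close>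
  implies \<open>f(X) \<preceq> f(Y) \<preceq> (1 + c) f(X) - cQ\<close>. By observability the \<open>N\<close>-fold iterate of \<open>f\<^sub>1\<close> is bounded
  uniformly in \<open>X\<close>; since \<open>Q\<close> is positive definite, \<open>N\<close> consecutive arrivals therefore bring any two
  comparable matrices within a uniform ratio and shrink \<open>c\<close> by a uniform factor \<open>\<rho> < 1\<close>.

  Almost surely infinitely many such runs occur, so the backward iterates
  \<open>f\<^bsub>\<gamma>\<^sub>0\<^esub> \<circ> \<dots> \<circ> f\<^bsub>\<gamma>\<^sub>t\<^esub> (X)\<close> converge almost surely, uniformly in \<open>X\<close>, to a limit independent of \<open>X\<close>.
  They have the same one-dimensional laws as the Riccati sequence, and the law of their limit is the
  invariant distribution.\<close>

text \<open>A norm contraction is out of reach: with an unstable \<open>A\<close> the open loop map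
  expands distances, and losses may undo what arrivals gain. The constant \<open>c\<close> of
  \<open>loewner_close\<close> is a quantity that neither map can increase, so losses cost nothing.
  No finite ratio compares a nonzero matrix with \<open>0\<close>, however; hence the innermost run
  has to create a ratio before the outer runs can shrink it. Both constants come from one number
  \<open>q\<close>, a fraction of \<open>block X\<close> that \<open>Q\<close> dominates for all
  \<open>X\<close>: the first ratio is \<open>1 / q - 1\<close>, the factor is \<open>1 - q\<close>.

  Backward order lets the newest coin act innermost, where coalescence erases it. Uniformity over
  the cone then also gives uniqueness, by starting from an arbitrary invariant law, and the support:
  a word followed by arrivals only has its orbit point as limit, and every stream with the same long
  prefix has a limit nearby.\<close>

declare transpose_matrix_vector [simp del]

section \<open>Quadratic forms\<close>

abbreviation quad :: "real^'n^'n \<Rightarrow> real^'n \<Rightarrow> real" where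
  "quad X v \<equiv> v \<bullet> (X *v v)"

lemma symmetric_matrix_inner:
  assumes "symmetric_matrix X"
  shows "u \<bullet> (X *v w) = w \<bullet> (X *v u)"
  using assms unfolding symmetric_matrix_def
  by (metis dot_lmul_matrix inner_commute transpose_matrix_vector)

lemma inner_transpose: "u \<bullet> (transpose X *v w) = (X *v u) \<bullet> (w::real^'m)"
  by (metis dot_lmul_matrix transpose_matrix_vector transpose_transpose)

lemma quad_diff:
  assumes "symmetric_matrix X"
  shows "quad X (u - w) = quad X u - 2 * (w \<bullet> (X *v u)) + quad X w"
  using symmetric_matrix_inner[OF assms, of u w] by (simp add: algebra_simps)

lemma quad_add:
  assumes "symmetric_matrix X"
  shows "quad X (u + w) = quad X u + 2 * (w \<bullet> (X *v u)) + quad X w"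
  using symmetric_matrix_inner[OF assms, of u w] by (simp add: algebra_simps)

lemma psd_cone_iff: "X \<in> psd_cone \<longleftrightarrow> symmetric_matrix X \<and> (\<forall>v. 0 \<le> quad X v)"
  by (simp add: psd_cone_def pos_semidef_def)

lemma psd_cone_symmetric: "X \<in> psd_cone \<Longrightarrow> symmetric_matrix X"
  by (simp add: psd_cone_iff)

lemma psd_cone_quad_nonneg: "X \<in> psd_cone \<Longrightarrow> 0 \<le> quad X v"
  by (simp add: psd_cone_iff)

lemma symmetric_matrix_diff: "symmetric_matrix X \<Longrightarrow> symmetric_matrix Y \<Longrightarrow> symmetric_matrix (X - Y)"
  by (simp add: symmetric_matrix_def transpose_def vec_eq_iff)

lemma loewner_le_iff:
  assumes "X \<in> psd_cone" "Y \<in> psd_cone"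
  shows "X \<preceq> Y \<longleftrightarrow> (\<forall>v. quad X v \<le> quad Y v)"
  using assms by (simp add: loewner_le_def pos_semidef_def psd_cone_iff symmetric_matrix_diff
      matrix_vector_mult_diff_rdistrib inner_diff_right)

section \<open>Norm estimates through quadratic forms\<close>

lemma entry_eq: "(X::real^'n^'m) $ i $ j = axis i 1 \<bullet> (X *v axis j 1)"
  by (simp add: inner_axis' matrix_vector_mult_basis column_def)

lemma norm_matrix_le:
  fixes D :: "real^'n^'m"
  assumes "\<And>i j. \<bar>D $ i $ j\<bar> \<le> c"
  shows "norm D \<le> c * CARD('m) * CARD('n)"
proof -
  have "norm D \<le> (\<Sum>i\<in>UNIV. norm (D $ i))"
    unfolding norm_vec_def by (rule L2_set_le_sum) simp
  also have "\<dots> \<le> (\<Sum>i\<in>UNIV. \<Sum>j\<in>UNIV. \<bar>D $ i $ j\<bar>)"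
    by (intro sum_mono norm_le_l1_cart)
  also have "\<dots> \<le> (\<Sum>i\<in>(UNIV::'m set). \<Sum>j\<in>(UNIV::'n set). c)"
    by (intro sum_mono assms)
  finally show ?thesis by (simp add: mult_ac)
qed

lemma norm_matrix_vector_le: "norm ((X::real^'n^'m) *v v) \<le> norm X * norm v"
proof -
  have "norm (X *v v) = L2_set (\<lambda>i. norm (X $ i \<bullet> v)) UNIV"
    by (simp only: norm_vec_def[of "X *v v"] matrix_vector_mul_component)
  also have "\<dots> \<le> L2_set (\<lambda>i. norm (X $ i) * norm v) UNIV"
    by (intro L2_set_mono) (auto simp: Cauchy_Schwarz_ineq2)
  also have "\<dots> = norm X * norm v"
    by (simp add: norm_vec_def[of X] L2_set_left_distrib)
  finally show ?thesis .
qed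

lemma abs_quad_le: "\<bar>quad X v\<bar> \<le> norm X * (norm v)\<^sup>2"
proof -
  have "\<bar>quad X v\<bar> \<le> norm v * norm (X *v v)" by (rule Cauchy_Schwarz_ineq2)
  also have "\<dots> \<le> norm v * (norm X * norm v)"
    by (intro mult_left_mono norm_matrix_vector_le) auto
  finally show ?thesis by (simp add: power2_eq_square mult_ac)
qed

text \<open>Polarisation recovers an entry from the form at \<open>a + b\<close> and
  \<open>a - b\<close>, and the parallelogram law makes the two error terms add up to exactly
  \<open>4 * c\<close>.\<close>

lemma norm_le_quad:
  fixes D :: "real^'n^'n"
  assumes "symmetric_matrix D" and le: "\<And>v. \<bar>quad D v\<bar> \<le> c * (norm v)\<^sup>2"
  shows "norm D \<le> c * CARD('n) * CARD('n)"
proof (rule norm_matrix_le)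
  fix i j
  define a b :: "real^'n" where "a = axis i 1" and "b = axis j 1"
  have "4 * (a \<bullet> (D *v b)) = quad D (a + b) - quad D (a - b)"
    using quad_add[OF assms(1), of a b] quad_diff[OF assms(1), of a b]
      symmetric_matrix_inner[OF assms(1), of a b] by simp
  moreover have "(norm (a + b))\<^sup>2 + (norm (a - b))\<^sup>2 = 2 * (norm a)\<^sup>2 + 2 * (norm b)\<^sup>2"
    by (simp add: power2_norm_eq_inner algebra_simps)
  moreover have "norm a = 1" "norm b = 1" by (simp_all add: a_def b_def)
  ultimately have "(norm (a + b))\<^sup>2 + (norm (a - b))\<^sup>2 = 4" by simp
  then have "c * (norm (a + b))\<^sup>2 + c * (norm (a - b))\<^sup>2 = 4 * c"
    by (metis distrib_left mult.commute)
  then have "\<bar>a \<bullet> (D *v b)\<bar> \<le> c"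
    using le[of "a + b"] le[of "a - b"] \<open>4 * (a \<bullet> (D *v b)) = _\<close> by linarith
  then show "\<bar>D $ i $ j\<bar> \<le> c" by (simp add: entry_eq a_def b_def)
qed

text \<open>For a semidefinite form the off-diagonal entries are dominated by the mean of two
  diagonal ones, so finitely many test vectors suffice. This serves \<open>block_bounded\<close>,
  where a bound is known only separately for each vector.\<close>

lemma norm_psd_le_diagonal:
  fixes D :: "real^'n^'n"
  assumes "D \<in> psd_cone" and le: "\<And>i. quad D (axis i 1) \<le> c"
  shows "norm D \<le> c * CARD('n) * CARD('n)"
proof (rule norm_matrix_le)
  fix i j
  define a b :: "real^'n" where "a = axis i 1" and "b = axis j 1"
  have "0 \<le> quad D (a + b)" "0 \<le> quad D (a - b)"
    using assms(1) psd_cone_quad_nonneg by blast+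
  then have "\<bar>a \<bullet> (D *v b)\<bar> \<le> c"
    using quad_add[OF psd_cone_symmetric[OF assms(1)], of a b] le[of i] le[of j]
      quad_diff[OF psd_cone_symmetric[OF assms(1)], of a b]
      symmetric_matrix_inner[OF psd_cone_symmetric[OF assms(1)], of a b]
    unfolding a_def[symmetric] b_def[symmetric] by linarith
  then show "\<bar>D $ i $ j\<bar> \<le> c" by (simp add: entry_eq a_def b_def)
qed

section \<open>Closedness of the cone and of its order intervals\<close>

lemma continuous_quad: "continuous_on S (\<lambda>X. quad X v)"
  by (simp only: matrix_mult_dot inner_vec_def) (intro continuous_intros)

lemma closed_psd_cone: "closed (psd_cone :: (real^'n^'n) set)"
proof -
  have *: "psd_cone = (\<Inter>i j. {X :: real^'n^'n. X $ i $ j = X $ j $ i}) \<inter> (\<Inter>v. {X. 0 \<le> quad X v})"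
    by (auto simp: psd_cone_iff symmetric_matrix_def transpose_def vec_eq_iff)
  show ?thesis
    unfolding *
    by (intro closed_Int closed_INT ballI closed_Collect_eq closed_Collect_le continuous_quad)
       (auto intro!: continuous_intros)
qed

lemma closed_loewner_ge:
  assumes "P \<in> psd_cone"
  shows "closed {Y \<in> psd_cone. P \<preceq> Y}"
proof -
  have *: "{Y \<in> psd_cone. P \<preceq> Y} = psd_cone \<inter> (\<Inter>v. {Y. quad P v \<le> quad Y v})"
    using loewner_le_iff[OF assms] by blast
  show ?thesis
    unfolding *
    by (intro closed_Int closed_psd_cone closed_INT ballI closed_Collect_le continuous_quad)
       (auto intro!: continuous_intros)
qed

section \<open>Positive definite matrices\<close>

lemma pos_def_lower_bound:
  fixes X :: "real^'n^'n"
  assumes "pos_def X"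
  obtains c where "c > 0" "\<And>v. c * (norm v)\<^sup>2 \<le> quad X v"
proof -
  have "continuous_on (sphere 0 1) (quad X)"
    by (intro continuous_on_inner continuous_on_id matrix_vector_mult_linear_continuous_on)
  moreover have "sphere 0 1 \<noteq> ({} :: (real^'n) set)"
    by simp
  ultimately have "\<exists>w\<in>sphere 0 1. \<forall>v\<in>sphere 0 1. quad X w \<le> quad X v"
    by (intro continuous_attains_inf compact_sphere)
  then obtain w where w: "w \<in> sphere 0 1" "\<And>v. v \<in> sphere 0 1 \<Longrightarrow> quad X w \<le> quad X v"
    by blast
  show thesis
  proof
    have "w \<noteq> 0" using w(1) by auto
    then show "quad X w > 0" using assms by (simp add: pos_def_def)
    fix v
    show "quad X w * (norm v)\<^sup>2 \<le> quad X v"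
    proof (cases "v = 0")
      case False
      define s where "s = v /\<^sub>R norm v"
      have "norm s = 1" using False by (simp add: s_def)
      then have "quad X w * (norm v)\<^sup>2 \<le> quad X s * (norm v)\<^sup>2"
        using w(2)[of s] by (intro mult_right_mono) auto
      moreover have "quad X v = quad X s * (norm v)\<^sup>2"
        using False by (simp add: s_def matrix_vector_mult_scaleR power2_eq_square field_simps)
      ultimately show ?thesis by simp
    qed simp
  qed
qed

lemma pos_def_invertible:
  fixes S :: "real^'n^'n"
  assumes "pos_def S"
  shows "S ** matrix_inv S = mat 1"
proof -
  have "inj ((*v) S)"
  proof (rule injI)
    fix x y assume "S *v x = S *v y"
    then have "quad S (x - y) = 0" by (simp add: algebra_simps)
    then have "\<not> x - y \<noteq> 0" using assms unfolding pos_def_def by (metis less_irrefl)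
    then show "x = y" by simp
  qed
  then obtain B where "B ** S = mat 1"
    using matrix_left_invertible_injective by blast
  then have "\<exists>B. S ** B = mat 1 \<and> B ** S = mat 1"
    using matrix_left_right_inverse by blast
  then have "S ** matrix_inv S = mat 1 \<and> matrix_inv S ** S = mat 1"
    unfolding matrix_inv_def by (rule someI_ex)
  then show ?thesis ..
qed

lemma symmetric_matrix_inv:
  fixes S :: "real^'n^'n"
  assumes "pos_def S"
  shows "symmetric_matrix (matrix_inv S)"
proof -
  let ?T = "transpose (matrix_inv S)"
  have "transpose S = S" using assms by (simp add: pos_def_def symmetric_matrix_def)
  then have "?T ** S = transpose (S ** matrix_inv S)"
    by (simp add: matrix_transpose_mul)
  also have "\<dots> = mat 1" by (simp add: pos_def_invertible[OF assms])
  finally have "(?T ** S) ** matrix_inv S = matrix_inv S" by simp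
  then have "?T = matrix_inv S"
    by (simp add: matrix_mul_assoc[symmetric] pos_def_invertible[OF assms])
  then show ?thesis by (simp add: symmetric_matrix_def)
qed

section \<open>The Riccati maps as partial minimisations\<close>

lemma transpose_add: "transpose (X + Y) = transpose X + transpose Y"
  and transpose_diff: "transpose (X - Y) = transpose X - transpose (Y :: real^'n^'m)"
  by (simp_all add: transpose_def vec_eq_iff)

lemma quad_congruence: "quad (B ** X ** transpose B) v = quad X (transpose B *v v)"
  using inner_transpose[where X = "transpose B" and u = v and w = "X *v (transpose B *v v)"]
  by (simp add: matrix_vector_mul_assoc[symmetric])

text \<open>A one-sided multiplicative distance in the spirit of Thompson's part metric: it is
  preserved by congruence with \<open>A\<close>, however expanding. The order between
  \<open>X\<close> and \<open>Y\<close> is built in, so that a single ratio has to be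
  tracked.\<close>

definition loewner_close :: "real \<Rightarrow> real^'n^'n \<Rightarrow> real^'n^'n \<Rightarrow> bool" where
  "loewner_close c X Y \<longleftrightarrow> (\<forall>v. quad X v \<le> quad Y v \<and> quad Y v \<le> (1 + c) * quad X v)"

text \<open>Translates ratios back into norms; because of the factor \<open>norm X\<close>, small
  ratios have to be accompanied by uniform boundedness.\<close>

lemma norm_loewner_close:
  fixes X Y :: "real^'n^'n"
  assumes "X \<in> psd_cone" "Y \<in> psd_cone" "loewner_close c X Y" "0 \<le> c"
  shows "norm (Y - X) \<le> c * norm X * CARD('n) * CARD('n)"
proof (rule norm_le_quad)
  show "symmetric_matrix (Y - X)"
    using assms by (simp add: psd_cone_symmetric symmetric_matrix_diff)
  fix v
  have "\<bar>quad (Y - X) v\<bar> \<le> c * quad X v"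
    using assms(3) unfolding loewner_close_def
    by (simp add: matrix_vector_mult_diff_rdistrib inner_diff_right algebra_simps)
  also have "\<dots> \<le> c * (norm X * (norm v)\<^sup>2)"
    using abs_quad_le[where X = X and v = v] \<open>0 \<le> c\<close> by (intro mult_left_mono) auto
  finally show "\<bar>quad (Y - X) v\<bar> \<le> c * norm X * (norm v)\<^sup>2" by (simp add: mult_ac)
qed

locale riccati =
  fixes A Q :: "real^'n^'n" and C :: "real^'n^'m" and R :: "real^'m^'m"
  assumes observable: "observable C A" and pos_def_Q: "pos_def Q" and pos_def_R: "pos_def R"
begin

abbreviation f where "f \<equiv> riccati_map A C Q R"

text \<open>One step of the dual linear-quadratic regulator: state \<open>v\<close>, control
  \<open>u\<close>, dynamics given by the transposes of \<open>A\<close> and \<open>C\<close>,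
  terminal weight \<open>X\<close>.\<close>

definition stage_cost :: "real^'n^'n \<Rightarrow> real^'n \<Rightarrow> real^'m \<Rightarrow> real" where
  "stage_cost X v u = quad X (transpose A *v v - transpose C *v u) + quad Q v + quad R u"

lemma quad_Q_nonneg: "0 \<le> quad Q v"
  using pos_def_Q unfolding pos_def_def by (cases "v = 0") (auto intro: less_imp_le)

lemma quad_R_nonneg: "0 \<le> quad R u"
  using pos_def_R unfolding pos_def_def by (cases "u = 0") (auto intro: less_imp_le)

lemma symmetric_Q: "symmetric_matrix Q" and symmetric_R: "symmetric_matrix R"
  using pos_def_Q pos_def_R by (auto simp: pos_def_def)

lemma quad_riccati_open: "quad (f False X) v = stage_cost X v 0"
  using quad_congruence[where B = A and X = X and v = v]
  by (simp add: riccati_map_def riccati_open_def stage_cost_def matrix_vector_mult_add_rdistrib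
      inner_add_right)

lemma pos_def_innovation:
  assumes "X \<in> psd_cone"
  shows "pos_def (C ** X ** transpose C + R)"
  unfolding pos_def_def
proof (intro conjI allI impI)
  show "symmetric_matrix (C ** X ** transpose C + R)"
    using psd_cone_symmetric[OF assms] symmetric_R
    by (simp add: symmetric_matrix_def transpose_add matrix_transpose_mul matrix_mul_assoc)
  fix u :: "real^'m" assume "u \<noteq> 0"
  then have "0 < quad R u" using pos_def_R by (simp add: pos_def_def)
  moreover have "0 \<le> quad (C ** X ** transpose C) u"
    unfolding quad_congruence using assms by (rule psd_cone_quad_nonneg)
  ultimately show "0 < quad (C ** X ** transpose C + R) u"
    by (simp add: matrix_vector_mult_add_rdistrib inner_add_right)
qed

text \<open>The minimiser \<open>w\<close> is the transposed Kalman gain applied to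
  \<open>v\<close>. Only its existence is exported, because the later estimates use an optimal
  control but never its formula.\<close>

lemma quad_riccati_closed:
  assumes X: "X \<in> psd_cone"
  obtains w where "\<And>u. stage_cost X v u = quad (f True X) v + quad (C ** X ** transpose C + R) (u - w)"
proof -
  define S where "S = C ** X ** transpose C + R"
  define a where "a = transpose A *v v"
  define b where "b = C *v (X *v a)"
  define w where "w = matrix_inv S *v b"
  have S: "pos_def S" unfolding S_def by (rule pos_def_innovation[OF X])
  then have symS: "symmetric_matrix S" by (simp add: pos_def_def)
  have Sw: "S *v w = b"
    by (simp add: w_def matrix_vector_mul_assoc pos_def_invertible[OF S])
  have cross: "(transpose C *v z) \<bullet> (X *v a) = z \<bullet> b" for z
    using inner_transpose[where X = "transpose C" and u = z and w = "X *v a"] by (simp add: b_def)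
  have "f True X *v v = A *v (X *v a) + Q *v v - A *v (X *v (transpose C *v w))"
    by (simp add: riccati_map_def riccati_closed_def matrix_vector_mult_add_rdistrib
        matrix_vector_mult_diff_rdistrib a_def b_def w_def S_def matrix_vector_mul_assoc matrix_mul_assoc)
  moreover have "v \<bullet> (A *v z) = a \<bullet> z" for z
    using inner_transpose[where X = "transpose A" and u = v and w = z] by (simp add: a_def)
  ultimately have closed: "quad (f True X) v = quad X a + quad Q v - w \<bullet> b"
    using symmetric_matrix_inner[OF psd_cone_symmetric[OF X], of a "transpose C *v w"] cross[of w]
    by (simp add: inner_add_right inner_diff_right)
  have "stage_cost X v u = quad (f True X) v + quad S (u - w)" for u
  proof -
    have "quad S u = quad X (transpose C *v u) + quad R u"
      using quad_congruence[where B = C and X = X and v = u]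
      by (simp add: S_def matrix_vector_mult_add_rdistrib inner_add_right)
    moreover have "quad S (u - w) = quad S u - 2 * (u \<bullet> b) + w \<bullet> b"
      using quad_diff[OF symS, of u w] symmetric_matrix_inner[OF symS, of w u] by (simp add: Sw)
    moreover have "stage_cost X v u = quad X a - 2 * (u \<bullet> b) + quad X (transpose C *v u) + quad Q v + quad R u"
      using quad_diff[OF psd_cone_symmetric[OF X], of a "transpose C *v u"] cross[of u]
      by (simp add: stage_cost_def a_def[symmetric])
    ultimately show ?thesis by (simp add: closed)
  qed
  then show thesis using that unfolding S_def by blast
qed

lemma riccati_closed_le:
  assumes "X \<in> psd_cone"
  shows "quad (f True X) v \<le> stage_cost X v u"
proof -
  obtain w where w: "\<And>u. stage_cost X v u = quad (f True X) v + quad (C ** X ** transpose C + R) (u - w)"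
    using quad_riccati_closed[OF assms] by blast
  have "0 \<le> quad (C ** X ** transpose C + R) (u - w)"
    using pos_def_innovation[OF assms] unfolding pos_def_def
    by (cases "u - w = 0") (auto intro: less_imp_le)
  then show ?thesis using w[of u] by simp
qed

text \<open>One and the same control is optimal at \<open>X\<close> and admissible at every other \<open>Y\<close>; for the
  open loop map the only admissible control is \<open>0\<close>.\<close>

lemma riccati_map_attained:
  assumes "X \<in> psd_cone"
  obtains u where "quad (f i X) v = stage_cost X v u"
    and "\<And>Y. Y \<in> psd_cone \<Longrightarrow> quad (f i Y) v \<le> stage_cost Y v u"
proof (cases i)
  case True
  obtain w where "\<And>u. stage_cost X v u = quad (f True X) v + quad (C ** X ** transpose C + R) (u - w)"
    using quad_riccati_closed[OF assms] by blast
  then have "quad (f i X) v = stage_cost X v w" using True by simp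
  then show ?thesis using that riccati_closed_le True by simp
next
  case False
  then show ?thesis using that quad_riccati_open by simp
qed

lemma riccati_map_le_open:
  assumes "X \<in> psd_cone"
  shows "quad (f i X) v \<le> stage_cost X v 0"
  using riccati_closed_le[OF assms, where v = v and u = 0] quad_riccati_open[where X = X and v = v] by (cases i) auto

section \<open>Monotonicity, ratio bounds and continuity of the maps\<close>

lemma quad_Q_le:
  assumes "X \<in> psd_cone"
  shows "quad Q v \<le> quad (f i X) v"
proof -
  obtain u where "quad (f i X) v = stage_cost X v u"
    using riccati_map_attained[OF assms] by blast
  then show ?thesis
    using psd_cone_quad_nonneg[OF assms, of "transpose A *v v - transpose C *v u"] quad_R_nonneg[of u]
    by (simp add: stage_cost_def)
qed

lemma riccati_map_psd:
  assumes X: "X \<in> psd_cone"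
  shows "f i X \<in> psd_cone"
proof -
  have t: "transpose X = X" "transpose Q = Q"
    using psd_cone_symmetric[OF X] symmetric_Q by (auto simp: symmetric_matrix_def)
  have "transpose (matrix_inv (C ** X ** transpose C + R)) = matrix_inv (C ** X ** transpose C + R)"
    using symmetric_matrix_inv[OF pos_def_innovation[OF X]] by (simp add: symmetric_matrix_def)
  then have "symmetric_matrix (f i X)"
    using t by (simp add: symmetric_matrix_def riccati_map_def riccati_open_def riccati_closed_def
        transpose_add transpose_diff matrix_transpose_mul matrix_mul_assoc)
  then show ?thesis
    using quad_Q_le[OF X] quad_Q_nonneg by (auto simp: psd_cone_iff intro: order_trans)
qed

lemma riccati_map_mono:
  assumes "X \<in> psd_cone" "Y \<in> psd_cone" and le: "\<And>v. quad X v \<le> quad Y v"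
  shows "quad (f i X) v \<le> quad (f i Y) v"
proof -
  obtain u where u: "quad (f i Y) v = stage_cost Y v u" "quad (f i X) v \<le> stage_cost X v u"
    using riccati_map_attained[OF assms(2)] assms(1) by metis
  then show ?thesis
    using le[of "transpose A *v v - transpose C *v u"] by (simp add: stage_cost_def)
qed

text \<open>The additive term \<open>Q\<close> does not get scaled; this is what makes the maps strict contractions
  on bounded sets.\<close>

lemma riccati_map_subhomogeneous:
  assumes X: "X \<in> psd_cone" and Y: "Y \<in> psd_cone" and "0 \<le> c" and close: "loewner_close c X Y"
  shows "quad (f i Y) v \<le> (1 + c) * quad (f i X) v - c * quad Q v"
proof -
  obtain u where u: "quad (f i X) v = stage_cost X v u" "quad (f i Y) v \<le> stage_cost Y v u"
    using riccati_map_attained[OF X] Y by metis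
  let ?x = "transpose A *v v - transpose C *v u"
  have "quad Y ?x \<le> (1 + c) * quad X ?x" using close by (simp add: loewner_close_def)
  moreover have "0 \<le> c * quad R u" using \<open>0 \<le> c\<close> quad_R_nonneg by simp
  ultimately have "stage_cost Y v u \<le> (1 + c) * stage_cost X v u - c * quad Q v"
    by (simp add: stage_cost_def algebra_simps)
  then show ?thesis using u by simp
qed

text \<open>Dropping the gain \<open>c * quad Q v\<close> leaves plain nonexpansiveness, which is
  all that a step outside a complete run has to provide.\<close>

lemma riccati_map_loewner_close:
  assumes "X \<in> psd_cone" "Y \<in> psd_cone" "0 \<le> c" "loewner_close c X Y"
  shows "loewner_close c (f i X) (f i Y)"
  unfolding loewner_close_def
proof (intro allI conjI)
  fix v
  show "quad (f i X) v \<le> quad (f i Y) v"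
    using assms by (intro riccati_map_mono) (auto simp: loewner_close_def)
  have "0 \<le> c * quad Q v" using \<open>0 \<le> c\<close> quad_Q_nonneg by simp
  then show "quad (f i Y) v \<le> (1 + c) * quad (f i X) v"
    using riccati_map_subhomogeneous[OF assms, where i = i and v = v] by linarith
qed

text \<open>The control optimal at \<open>X\<close> grows at most linearly in \<open>v\<close>: its
  cost cannot exceed that of the zero control, and \<open>R\<close> is coercive. Inserting this
  control at \<open>Y\<close> changes the cost only through \<open>Y - X\<close>, so the matrix
  inverse never has to be estimated. Only \<open>X\<close> has to be bounded.\<close>

lemma riccati_map_one_sided_lipschitz:
  obtains L where "L \<ge> 0" "\<And>X Y v. X \<in> psd_cone \<Longrightarrow> Y \<in> psd_cone \<Longrightarrow> norm X \<le> K \<Longrightarrow>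
    quad (f i Y) v \<le> quad (f i X) v + norm (X - Y) * (L * (norm v)\<^sup>2)"
proof -
  obtain r where r: "r > 0" "\<And>u. r * (norm u)\<^sup>2 \<le> quad R u"
    using pos_def_lower_bound[OF pos_def_R] by blast
  define a where "a = norm (transpose A)"
  define c where "c = norm (transpose C)"
  define L where "L = 2 * a\<^sup>2 + 2 * (c\<^sup>2 * ((\<bar>K\<bar> * a\<^sup>2 + norm Q) / r))"
  have "L \<ge> 0" using r(1) by (simp add: L_def)
  moreover have "quad (f i Y) v \<le> quad (f i X) v + norm (X - Y) * (L * (norm v)\<^sup>2)"
    if X: "X \<in> psd_cone" and Y: "Y \<in> psd_cone" and K: "norm X \<le> K" for X Y v
  proof -
    obtain u where u: "quad (f i X) v = stage_cost X v u" "quad (f i Y) v \<le> stage_cost Y v u"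
      using riccati_map_attained[OF X] Y by metis
    let ?x = "transpose A *v v - transpose C *v u"
    have a: "norm (transpose A *v v) \<le> a * norm v" and c: "norm (transpose C *v u) \<le> c * norm u"
      unfolding a_def c_def by (rule norm_matrix_vector_le)+
    have a2: "(norm (transpose A *v v))\<^sup>2 \<le> a\<^sup>2 * (norm v)\<^sup>2"
      and c2: "(norm (transpose C *v u))\<^sup>2 \<le> c\<^sup>2 * (norm u)\<^sup>2"
      using power_mono[OF a, of 2] power_mono[OF c, of 2] by (simp_all add: power_mult_distrib)
    have "r * (norm u)\<^sup>2 \<le> quad R u" by (rule r)
    also have "\<dots> \<le> stage_cost X v u"
      using psd_cone_quad_nonneg[OF X, of ?x] quad_Q_nonneg[of v] by (simp add: stage_cost_def)
    also have "\<dots> \<le> stage_cost X v 0" using riccati_map_le_open[OF X, where i = i and v = v] u by simp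
    also have "\<dots> = quad X (transpose A *v v) + quad Q v" by (simp add: stage_cost_def)
    also have "\<dots> \<le> \<bar>K\<bar> * (a\<^sup>2 * (norm v)\<^sup>2) + norm Q * (norm v)\<^sup>2"
    proof (rule add_mono)
      have "quad X (transpose A *v v) \<le> norm X * (norm (transpose A *v v))\<^sup>2"
        using abs_quad_le[where X = X and v = "transpose A *v v"] by linarith
      also have "\<dots> \<le> \<bar>K\<bar> * (a\<^sup>2 * (norm v)\<^sup>2)"
        using K a2 by (intro mult_mono) auto
      finally show "quad X (transpose A *v v) \<le> \<bar>K\<bar> * (a\<^sup>2 * (norm v)\<^sup>2)" .
      show "quad Q v \<le> norm Q * (norm v)\<^sup>2" using abs_quad_le[where X = Q and v = v] by linarith
    qed
    finally have "(norm u)\<^sup>2 \<le> (\<bar>K\<bar> * a\<^sup>2 + norm Q) / r * (norm v)\<^sup>2"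
      using r(1) by (simp add: field_simps)
    then have "c\<^sup>2 * (norm u)\<^sup>2 \<le> c\<^sup>2 * ((\<bar>K\<bar> * a\<^sup>2 + norm Q) / r * (norm v)\<^sup>2)"
      by (intro mult_left_mono) auto
    then have "2 * (norm (transpose A *v v))\<^sup>2 + 2 * (norm (transpose C *v u))\<^sup>2
        \<le> 2 * (a\<^sup>2 * (norm v)\<^sup>2) + 2 * (c\<^sup>2 * ((\<bar>K\<bar> * a\<^sup>2 + norm Q) / r * (norm v)\<^sup>2))"
      using a2 c2 by linarith
    also have "\<dots> = L * (norm v)\<^sup>2" by (simp add: L_def algebra_simps)
    finally have *: "2 * (norm (transpose A *v v))\<^sup>2 + 2 * (norm (transpose C *v u))\<^sup>2 \<le> L * (norm v)\<^sup>2" .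
    \<comment> \<open>Parallelogram law; dropping the second square bounds \<open>?x\<close> without
      a mixed term.\<close>
    have "(norm ?x)\<^sup>2 + (norm (transpose A *v v + transpose C *v u))\<^sup>2
        = 2 * (norm (transpose A *v v))\<^sup>2 + 2 * (norm (transpose C *v u))\<^sup>2"
      by (simp add: power2_norm_eq_inner algebra_simps)
    then have x: "(norm ?x)\<^sup>2 \<le> L * (norm v)\<^sup>2"
      using * zero_le_power2[of "norm (transpose A *v v + transpose C *v u)"] by linarith
    have "quad Y ?x - quad X ?x = - quad (X - Y) ?x"
      by (simp add: matrix_vector_mult_diff_rdistrib inner_diff_right)
    also have "\<dots> \<le> norm (X - Y) * (norm ?x)\<^sup>2" using abs_quad_le[where X = "X - Y" and v = ?x] by linarith
    also have "\<dots> \<le> norm (X - Y) * (L * (norm v)\<^sup>2)" using x by (intro mult_left_mono) auto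
    finally show ?thesis using u by (simp add: stage_cost_def)
  qed
  ultimately show thesis using that by blast
qed

text \<open>The one-sided estimate is used in both directions, which is why \<open>K\<close> has to
  bound the sequence as well as its limit.\<close>

lemma continuous_on_riccati_map: "continuous_on psd_cone (f i)"
  unfolding continuous_on_sequentially
proof (intro allI ballI impI, elim conjE)
  fix x :: "nat \<Rightarrow> real^'n^'n" and a assume a: "a \<in> (psd_cone :: (real^'n^'n) set)" and x: "\<forall>n. x n \<in> psd_cone" and lim: "x \<longlonglongrightarrow> a"
  obtain K where K: "\<And>n. norm (x n) \<le> K" and "norm a \<le> K"
  proof -
    obtain B where "\<And>n. norm (x n) \<le> B"
      using convergent_imp_bounded[OF lim] by (auto simp: bounded_iff)
    then show thesis using that[of "max B (norm a)"] by (simp add: max.coboundedI1)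
  qed
  obtain L where L: "L \<ge> 0" "\<And>X Y v. X \<in> psd_cone \<Longrightarrow> Y \<in> psd_cone \<Longrightarrow> norm X \<le> K \<Longrightarrow>
    quad (f i Y) v \<le> quad (f i X) v + norm (X - Y) * (L * (norm v)\<^sup>2)"
    using riccati_map_one_sided_lipschitz by blast
  have bound: "norm (f i (x n) - f i a) \<le> (norm (x n - a) * L) * CARD('n) * CARD('n)" for n
  proof (rule norm_le_quad)
    show "symmetric_matrix (f i (x n) - f i a)"
      using x a by (simp add: psd_cone_symmetric riccati_map_psd symmetric_matrix_diff)
    fix v
    show "\<bar>quad (f i (x n) - f i a) v\<bar> \<le> norm (x n - a) * L * (norm v)\<^sup>2"
      using L(2)[of "x n" a v] L(2)[of a "x n" v] x a K[of n] \<open>norm a \<le> K\<close>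
      by (simp add: matrix_vector_mult_diff_rdistrib inner_diff_right norm_minus_commute[of a] mult_ac abs_le_iff)
  qed
  have "(\<lambda>n. norm (x n - a)) \<longlonglongrightarrow> 0" using lim by (simp add: LIM_zero_iff tendsto_norm_zero)
  then have "(\<lambda>n. (norm (x n - a) * L) * CARD('n) * CARD('n)) \<longlonglongrightarrow> 0 * L * CARD('n) * CARD('n)"
    by (intro tendsto_intros)
  then have "(\<lambda>n. (norm (x n - a) * L) * CARD('n) * CARD('n)) \<longlonglongrightarrow> 0"
    by simp
  then have "(\<lambda>n. f i (x n) - f i a) \<longlonglongrightarrow> 0"
    by (rule Lim_null_comparison[rotated]) (simp add: bound)
  then show "(f i \<circ> x) \<longlonglongrightarrow> f i a" by (simp add: LIM_zero_iff o_def)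
qed

subsection \<open>Observability\<close>

text \<open>The states that the dual pair, the transposes of \<open>A\<close> and \<open>C\<close>,
  can reach in \<open>n\<close> steps: the column space of its controllability matrix.\<close>

definition reachable :: "nat \<Rightarrow> (real^'n) set" where
  "reachable n = range (\<lambda>w. \<Sum>k<n. transpose (matrix_power A k) *v (transpose C *v w k))"

lemma reachableI:
  "x = (\<Sum>k<n. transpose (matrix_power A k) *v (transpose C *v w k)) \<Longrightarrow> x \<in> reachable n"
  unfolding reachable_def by blast

lemma subspace_reachable: "subspace (reachable n)"
  unfolding subspace_def
proof (intro conjI ballI allI)
  let ?g = "\<lambda>w. \<Sum>k<n. transpose (matrix_power A k) *v (transpose C *v w k)"
  have "0 = ?g (\<lambda>_. 0)" by simp
  then show "0 \<in> reachable n" by (rule reachableI)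
  fix x assume "x \<in> reachable n"
  then obtain w where w: "x = ?g w" by (auto simp: reachable_def)
  show "c *\<^sub>R x \<in> reachable n" for c
  proof -
    have "c *\<^sub>R x = ?g (\<lambda>k. c *\<^sub>R w k)"
      by (simp add: w scaleR_sum_right matrix_vector_mult_scaleR)
    then show ?thesis by (rule reachableI)
  qed
  fix y assume "y \<in> reachable n"
  then obtain z where "y = ?g z" by (auto simp: reachable_def)
  then have "x + y = ?g (\<lambda>k. w k + z k)"
    by (simp add: w sum.distrib matrix_vector_right_distrib)
  then show "x + y \<in> reachable n" by (rule reachableI)
qed

text \<open>Duality of observability and controllability: a row of
  \<open>C ** matrix_power A k\<close> is a column of the \<open>k\<close>-th controllability
  block.\<close>

lemma reachable_UNIV: "reachable CARD('n) = UNIV"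
proof -
  have "rows (C ** matrix_power A k) \<subseteq> reachable CARD('n)" if "k < CARD('n)" for k
  proof
    fix x assume "x \<in> rows (C ** matrix_power A k)"
    then obtain i where "x = row i (C ** matrix_power A k)" by (auto simp: rows_def)
    also have "\<dots> = transpose (C ** matrix_power A k) *v axis i 1"
      by (simp add: matrix_vector_mult_basis column_transpose)
    also have "\<dots> = transpose (matrix_power A k) *v (transpose C *v axis i 1)"
      by (simp add: matrix_transpose_mul matrix_vector_mul_assoc)
    also have "\<dots> = (\<Sum>l<CARD('n). if l = k then transpose (matrix_power A l) *v (transpose C *v axis i 1) else 0)"
      using that by simp
    also have "\<dots> = (\<Sum>l<CARD('n). transpose (matrix_power A l) *v
        (transpose C *v (if l = k then axis i 1 else 0)))"
      by (intro sum.cong) auto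
    finally show "x \<in> reachable CARD('n)" by (rule reachableI)
  qed
  then have "span (\<Union>k<CARD('n). rows (C ** matrix_power A k)) \<subseteq> reachable CARD('n)"
    by (intro span_minimal subspace_reachable) auto
  moreover have "span (\<Union>k<CARD('n). rows (C ** matrix_power A k)) = UNIV"
    using observable unfolding observable_def by (subst dim_eq_full[symmetric]) simp
  ultimately show ?thesis by blast
qed

lemma funpow_psd: "X \<in> psd_cone \<Longrightarrow> (f i ^^ k) X \<in> psd_cone"
  by (induction k) (auto intro: riccati_map_psd)

text \<open>A control steering \<open>v\<close> to \<open>0\<close> makes the cost independent of the terminal weight \<open>X\<close>.\<close>

lemma quad_funpow_bounded:
  assumes "transpose (matrix_power A n) *v v \<in> reachable n"
  shows "\<exists>c. \<forall>X\<in>psd_cone. quad ((f True ^^ n) X) v \<le> c"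
  using assms
proof (induction n arbitrary: v)
  case 0
  then have "v = 0" by (simp add: reachable_def transpose_mat)
  then show ?case by (auto intro!: exI[of _ 0])
next
  case (Suc n)
  then obtain w where w: "transpose (matrix_power A (Suc n)) *v v
      = (\<Sum>k<Suc n. transpose (matrix_power A k) *v (transpose C *v w k))"
    by (auto simp: reachable_def)
  \<comment> \<open>Since \<open>matrix_power A (Suc n) = A ** matrix_power A n\<close>, the control
    applied first is the one with the highest index; subtracting it leaves a steering problem of
    length \<open>n\<close> for \<open>?x\<close>.\<close>
  let ?x = "transpose A *v v - transpose C *v w n"
  have "transpose (matrix_power A n) *v ?x
      = (\<Sum>k<n. transpose (matrix_power A k) *v (transpose C *v w k))"
    using w by (simp add: matrix_transpose_mul matrix_vector_mult_diff_distrib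
        flip: matrix_vector_mul_assoc)
  then have "transpose (matrix_power A n) *v ?x \<in> reachable n"
    by (rule reachableI)
  then obtain c where c: "\<And>X. X \<in> psd_cone \<Longrightarrow> quad ((f True ^^ n) X) ?x \<le> c"
    using Suc.IH by blast
  show ?case
  proof (intro exI[of _ "c + quad Q v + quad R (w n)"] ballI)
    fix X :: "real^'n^'n" assume X: "X \<in> psd_cone"
    have "quad ((f True ^^ Suc n) X) v \<le> stage_cost ((f True ^^ n) X) v (w n)"
      using riccati_closed_le[OF funpow_psd[OF X]] by simp
    also have "\<dots> \<le> c + quad Q v + quad R (w n)"
      using c[OF X] by (simp add: stage_cost_def)
    finally show "quad ((f True ^^ Suc n) X) v \<le> c + quad Q v + quad R (w n)" .
  qed
qed

section \<open>Contraction by a run of arrivals\<close>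

definition block :: "real^'n^'n \<Rightarrow> real^'n^'n" where
  "block = f True ^^ CARD('n)"

lemma block_psd: "X \<in> psd_cone \<Longrightarrow> block X \<in> psd_cone"
  unfolding block_def by (rule funpow_psd)

lemma block_eq_step: "block X = f True ((f True ^^ (CARD('n) - 1)) X)"
  by (metis block_def One_nat_def Suc_pred comp_apply funpow.simps(2) zero_less_card_finite)

lemma block_bounded:
  obtains M where "M > 0" "\<And>X. X \<in> psd_cone \<Longrightarrow> norm (block X) \<le> M"
proof -
  have "\<exists>c. \<forall>X\<in>psd_cone. quad (block X) v \<le> c" for v
    unfolding block_def using quad_funpow_bounded reachable_UNIV by auto
  then obtain c where c: "\<And>v X. X \<in> psd_cone \<Longrightarrow> quad (block X) v \<le> c v" by metis
  \<comment> \<open>The bound \<open>c\<close> is an arbitrary function of the test vector, so only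
    its values at the basis vectors are used. The \<open>max 1\<close> keeps \<open>M\<close>
    positive, as it becomes a denominator.\<close>
  let ?d = "Max (range (\<lambda>i::'n. c (axis i 1)))"
  have "norm (block X) \<le> max 1 (?d * CARD('n) * CARD('n))" if "X \<in> psd_cone" for X
  proof -
    have "norm (block X) \<le> ?d * CARD('n) * CARD('n)"
    proof (rule norm_psd_le_diagonal)
      show "block X \<in> psd_cone" using that by (rule block_psd)
      fix i :: 'n
      have "quad (block X) (axis i 1) \<le> c (axis i 1)" using c that by blast
      also have "\<dots> \<le> ?d" by (intro Max_ge) auto
      finally show "quad (block X) (axis i 1) \<le> ?d" .
    qed
    then show ?thesis by simp
  qed
  then show thesis using that[of "max 1 (?d * CARD('n) * CARD('n))"] by auto
qed

text \<open>A floor for \<open>Q\<close> over a ceiling for \<open>block X\<close>: the quotient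
  \<open>c / M\<close> is independent of \<open>X\<close>, although \<open>X\<close> ranges over an
  unbounded cone.\<close>

lemma block_lower_bound:
  obtains q where "q > 0" "\<And>X v. X \<in> psd_cone \<Longrightarrow> q * quad (block X) v \<le> quad Q v"
proof -
  obtain M where M: "M > 0" "\<And>X. X \<in> psd_cone \<Longrightarrow> norm (block X) \<le> M"
    using block_bounded by blast
  obtain c where c: "c > 0" "\<And>v. c * (norm v)\<^sup>2 \<le> quad Q v"
    using pos_def_lower_bound[OF pos_def_Q] by blast
  have "(c / M) * quad (block X) v \<le> quad Q v" if "X \<in> psd_cone" for X v
  proof -
    have "quad (block X) v \<le> norm (block X) * (norm v)\<^sup>2"
      using abs_quad_le[where X = "block X" and v = v] by linarith
    also have "\<dots> \<le> M * (norm v)\<^sup>2" using M(2)[OF that] by (intro mult_right_mono) auto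
    finally have "(c / M) * quad (block X) v \<le> (c / M) * (M * (norm v)\<^sup>2)"
      using M c by (intro mult_left_mono) auto
    also have "\<dots> \<le> quad Q v" using c(2)[of v] M(1) by simp
    finally show ?thesis .
  qed
  then show thesis using that[of "c / M"] M c by auto
qed

text \<open>For the first bound, \<open>q * block Y\<close> lies below \<open>Q\<close> and
  \<open>Q\<close> below \<open>block X\<close>, even for \<open>X = 0\<close>. For the second, the
  outermost step leaves the summand \<open>c * quad Q v\<close> unscaled, and this is at least the
  fraction \<open>q\<close> of \<open>c * quad (block X) v\<close>.\<close>

lemma block_contracts:
  obtains \<rho> c0 where "0 \<le> \<rho>" "\<rho> < 1" "0 \<le> c0"
    "\<And>X Y. X \<in> psd_cone \<Longrightarrow> Y \<in> psd_cone \<Longrightarrow> (\<And>v. quad X v \<le> quad Y v) \<Longrightarrow>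
       loewner_close c0 (block X) (block Y)"
    "\<And>X Y c. X \<in> psd_cone \<Longrightarrow> Y \<in> psd_cone \<Longrightarrow> 0 \<le> c \<Longrightarrow> loewner_close c X Y \<Longrightarrow>
       loewner_close (\<rho> * c) (block X) (block Y)"
proof -
  obtain q0 where q0: "q0 > 0" "\<And>X v. X \<in> psd_cone \<Longrightarrow> q0 * quad (block X) v \<le> quad Q v"
    using block_lower_bound by blast
  \<comment> \<open>Capping at \<open>1\<close> keeps both \<open>1 - q\<close> and
    \<open>1 / q - 1\<close> nonnegative.\<close>
  define q where "q = min q0 1"
  have q: "0 < q" "q \<le> 1" using q0 by (auto simp: q_def)
  have qQ: "q * quad (block X) v \<le> quad Q v" if "X \<in> psd_cone" for X v
  proof -
    have "q * quad (block X) v \<le> q0 * quad (block X) v"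
      using psd_cone_quad_nonneg[OF block_psd[OF that]] by (intro mult_right_mono) (auto simp: q_def)
    then show ?thesis using q0(2)[OF that, of v] by linarith
  qed
  have mono: "quad ((f True ^^ k) X) v \<le> quad ((f True ^^ k) Y) v"
    if "X \<in> psd_cone" "Y \<in> psd_cone" "\<And>v. quad X v \<le> quad Y v" for X Y k v
    using that(3)
  proof (induction k arbitrary: v)
    case (Suc k)
    then show ?case using that(1,2) by (auto intro!: riccati_map_mono funpow_psd)
  qed simp
  have close: "loewner_close c ((f True ^^ k) X) ((f True ^^ k) Y)"
    if "X \<in> psd_cone" "Y \<in> psd_cone" "0 \<le> c" "loewner_close c X Y" for X Y c k
    using that(4)
  proof (induction k)
    case (Suc k)
    then show ?case using that(1-3) by (auto intro!: riccati_map_loewner_close funpow_psd)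
  qed simp
  show thesis
  proof
    show "0 \<le> 1 - q" "1 - q < 1" "0 \<le> 1 / q - 1" using q by auto
  next
    fix X Y :: "real^'n^'n"
    assume X: "X \<in> psd_cone" and Y: "Y \<in> psd_cone" and le: "\<And>v. quad X v \<le> quad Y v"
    have "quad (block Y) v \<le> (1 + (1 / q - 1)) * quad (block X) v" for v
    proof -
      have "q * quad (block Y) v \<le> quad (block X) v"
        using qQ[OF Y, of v] quad_Q_le[OF funpow_psd[OF X], of v True "CARD('n) - 1" True]
        by (simp add: block_eq_step[of X])
      then show ?thesis using q by (simp add: field_simps)
    qed
    then show "loewner_close (1 / q - 1) (block X) (block Y)"
      using mono[OF X Y le] by (simp add: loewner_close_def block_def)
  next
    fix X Y :: "real^'n^'n" and c
    assume X: "X \<in> psd_cone" and Y: "Y \<in> psd_cone" and c: "0 \<le> c" and XY: "loewner_close c X Y"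
    show "loewner_close ((1 - q) * c) (block X) (block Y)"
      unfolding loewner_close_def
    proof (intro allI conjI)
      fix v
      show "quad (block X) v \<le> quad (block Y) v"
        using close[OF X Y c XY] by (simp add: loewner_close_def block_def)
      have "quad (block Y) v \<le> (1 + c) * quad (block X) v - c * quad Q v"
        unfolding block_eq_step
        by (intro riccati_map_subhomogeneous funpow_psd X Y c close XY)
      also have "\<dots> \<le> (1 + c) * quad (block X) v - c * (q * quad (block X) v)"
        using qQ[OF X, of v] c by (simp add: mult_left_mono)
      finally show "quad (block Y) v \<le> (1 + (1 - q) * c) * quad (block X) v"
        by (simp add: algebra_simps)
    qed
  qed
qed

end

section \<open>The topology and the Borel sets of the cone\<close>

lemma spectral_norm_le_norm: "spectral_norm X \<le> norm X"
  unfolding spectral_norm_def by (intro onorm_le norm_matrix_vector_le)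

lemma norm_le_spectral_norm:
  fixes X :: "real^'n^'n"
  shows "norm X \<le> spectral_norm X * CARD('n) * CARD('n)"
  unfolding spectral_norm_def by (intro norm_matrix_le matrix_component_le_onorm)

text \<open>The spectral and Frobenius norms differ at most by the factor \<open>?c\<close>, so
  topological and Borel questions move to the Euclidean subspace \<open>psd_cone\<close>.\<close>

lemma psd_mtopology: "psd.mtopology = top_of_set (psd_cone :: (real^'n^'n) set)"
proof -
  let ?c = "real CARD('n) * real CARD('n)"
  have "openin psd.mtopology U \<longleftrightarrow> openin (top_of_set psd_cone) U" for U :: "(real^'n^'n) set"
  proof (cases "U \<subseteq> psd_cone")
    case True
    have "(\<exists>r>0. psd.mball X r \<subseteq> U) \<longleftrightarrow> (\<exists>e>0. \<forall>Y\<in>psd_cone. dist Y X < e \<longrightarrow> Y \<in> U)"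
      if "X \<in> U" for X
    proof
      assume "\<exists>r>0. psd.mball X r \<subseteq> U"
      then obtain r where r: "r > 0" "psd.mball X r \<subseteq> U" by blast
      have "Y \<in> U" if "Y \<in> psd_cone" "dist Y X < r" for Y
      proof -
        have "spectral_dist X Y \<le> dist Y X"
          using spectral_norm_le_norm[of "X - Y"] by (simp add: spectral_dist_def dist_norm norm_minus_commute)
        then have "Y \<in> psd.mball X r"
          using that True \<open>X \<in> U\<close> by (simp add: psd.in_mball subsetD)
        then show ?thesis using r(2) by blast
      qed
      then show "\<exists>e>0. \<forall>Y\<in>psd_cone. dist Y X < e \<longrightarrow> Y \<in> U" using r(1) by blast
    next
      assume "\<exists>e>0. \<forall>Y\<in>psd_cone. dist Y X < e \<longrightarrow> Y \<in> U"
      then obtain e where e: "e > 0" "\<And>Y. Y \<in> psd_cone \<Longrightarrow> dist Y X < e \<Longrightarrow> Y \<in> U" by blast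
      have "psd.mball X (e / ?c) \<subseteq> U"
      proof
        fix Y assume Y: "Y \<in> psd.mball X (e / ?c)"
        then have "spectral_norm (X - Y) * ?c < e"
          by (simp add: psd.in_mball spectral_dist_def field_simps)
        then have "dist Y X < e"
          using norm_le_spectral_norm[of "X - Y"] by (simp add: dist_norm norm_minus_commute mult.assoc)
        then show "Y \<in> U" using e(2) Y by (simp add: psd.in_mball)
      qed
      moreover have "e / ?c > 0" using e(1) by simp
      ultimately show "\<exists>r>0. psd.mball X r \<subseteq> U" by blast
    qed
    then show ?thesis
      unfolding psd.openin_mtopology openin_euclidean_subtopology_iff using True by blast
  next
    case False
    then show ?thesis
      using openin_imp_subset unfolding psd.openin_mtopology by blast
  qed
  then show ?thesis unfolding topology_eq by blast
qed

lemma space_psd_borel: "space psd_borel = psd_cone"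
  by (simp add: psd_borel_def space_measure_of_conv)

lemma sets_psd_borel: "sets psd_borel = sets (restrict_space borel (psd_cone :: (real^'n^'n) set))"
proof -
  have "{U. openin psd.mtopology U} = (\<inter>) (psd_cone :: (real^'n^'n) set) ` {S. open S}"
    unfolding psd_mtopology by (auto simp: openin_open)
  then have "sets psd_borel = sigma_sets psd_cone ((\<inter>) (psd_cone :: (real^'n^'n) set) ` {S. open S})"
    unfolding psd_borel_def by (subst sets_measure_of) auto
  also have "\<dots> = (\<inter>) psd_cone ` sigma_sets UNIV {S :: (real^'n^'n) set. open S}"
    by (rule sigma_sets_Int[symmetric]) (auto intro: closed_psd_cone borel_closed simp flip: sets_borel)
  also have "\<dots> = sets (restrict_space borel psd_cone)"
    by (simp add: sets_restrict_space sets_borel)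
  finally show ?thesis .
qed

lemma sets_psd_borel_iff: "B \<in> sets psd_borel \<longleftrightarrow> B \<subseteq> psd_cone \<and> B \<in> sets borel"
  unfolding sets_psd_borel
  by (subst sets_restrict_space_iff) (auto intro: borel_closed closed_psd_cone)

lemma measurable_psd_borel_iff:
  "h \<in> M \<rightarrow>\<^sub>M psd_borel \<longleftrightarrow> h \<in> borel_measurable M \<and> h \<in> space M \<rightarrow> psd_cone"
  by (subst measurable_cong_sets[OF refl sets_psd_borel]) (auto simp: measurable_restrict_space2_iff)

lemma measurable_psd_borel_continuous:
  "continuous_on psd_cone h \<Longrightarrow> h \<in> borel_measurable psd_borel"
  by (subst measurable_cong_sets[OF sets_psd_borel refl]) (rule borel_measurable_continuous_on_restrict)

section \<open>Backward iteration\<close>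

context riccati
begin

lemma foldr_psd: "X \<in> psd_cone \<Longrightarrow> foldr f w X \<in> psd_cone"
  by (induction w) (auto intro: riccati_map_psd)

lemma continuous_on_foldr: "continuous_on psd_cone (foldr f w)"
proof (induction w)
  case (Cons i w)
  have "continuous_on psd_cone (\<lambda>X. f i (foldr f w X))"
    by (rule continuous_on_compose2[OF continuous_on_riccati_map Cons]) (auto intro: foldr_psd)
  then show ?case by (simp add: o_def)
qed (simp add: id_def)

lemma foldr_mono:
  assumes "X \<in> psd_cone" "Y \<in> psd_cone" "\<And>v. quad X v \<le> quad Y v"
  shows "quad (foldr f w X) v \<le> quad (foldr f w Y) v"
  using assms(3)
  by (induction w arbitrary: v) (auto intro!: riccati_map_mono foldr_psd assms(1,2))

lemma foldr_loewner_close: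
  assumes "X \<in> psd_cone" "Y \<in> psd_cone" "0 \<le> c" "loewner_close c X Y"
  shows "loewner_close c (foldr f w X) (foldr f w Y)"
  using assms(4)
  by (induction w) (auto intro!: riccati_map_loewner_close foldr_psd assms(1-3))

text \<open>\<open>foldr\<close> applies the head of the stream last. Lengthening the word therefore
  alters only the innermost argument, which makes pathwise convergence possible.\<close>

definition backward :: "nat \<Rightarrow> bool stream \<Rightarrow> real^'n^'n \<Rightarrow> real^'n^'n" where
  "backward n s = foldr f (stake n s)"

lemma backward_add: "backward (m + n) s X = backward m s (backward n (sdrop m s) X)"
  by (simp add: backward_def flip: stake_add)

lemma backward_psd: "X \<in> psd_cone \<Longrightarrow> backward n s X \<in> psd_cone"
  unfolding backward_def by (rule foldr_psd)

section \<open>Coalescence along streams with infinitely many runs\<close>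

lemma zero_psd: "0 \<in> psd_cone"
  by (simp add: psd_cone_iff symmetric_matrix_def transpose_def vec_eq_iff)

text \<open>Asking for runs at unbounded positions makes the property invariant under dropping and
  restoring prefixes.\<close>

definition regenerative :: "bool stream \<Rightarrow> bool" where
  "regenerative s \<longleftrightarrow>
     (\<forall>n. \<exists>m\<ge>n. stake CARD('n) (sdrop m s) = replicate CARD('n) True)"

lemma regenerative_sdrop: "regenerative s \<Longrightarrow> regenerative (sdrop k s)"
  unfolding regenerative_def
proof (intro allI)
  fix n
  assume "\<forall>n. \<exists>m\<ge>n. stake CARD('n) (sdrop m s) = replicate CARD('n) True"
  then obtain m where "m \<ge> n + k" "stake CARD('n) (sdrop m s) = replicate CARD('n) True" by blast
  then show "\<exists>m\<ge>n. stake CARD('n) (sdrop m (sdrop k s)) = replicate CARD('n) True"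
    by (intro exI[of _ "m - k"]) (simp add: sdrop_add)
qed

lemma backward_block:
  assumes "stake CARD('n) (sdrop m s) = replicate CARD('n) True"
  shows "backward (m + CARD('n) + n) s X = backward m s (block (backward n (sdrop (m + CARD('n)) s) X))"
proof -
  have "backward CARD('n) (sdrop m s) Y = block Y" for Y
    by (simp add: backward_def assms foldr_replicate block_def)
  then show ?thesis by (simp add: backward_add add.assoc sdrop_add)
qed

text \<open>The length \<open>n\<close> serves all pairs at once. The innermost run turns
  comparability into a ratio \<open>c0\<close>, each of the \<open>k\<close> runs outside it
  contributes a factor \<open>\<rho>\<close>, and the maps in between do no harm.\<close>

lemma regenerative_loewner_close:
  assumes "\<epsilon> > 0" "regenerative s"
  obtains n where "\<And>X Y. X \<in> psd_cone \<Longrightarrow> Y \<in> psd_cone \<Longrightarrow> (\<And>v. quad X v \<le> quad Y v) \<Longrightarrow>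
    loewner_close \<epsilon> (backward n s X) (backward n s Y)"
proof -
  obtain \<rho> c0 where \<rho>: "0 \<le> \<rho>" "\<rho> < 1" and c0: "0 \<le> c0"
    and base: "\<And>X Y. X \<in> psd_cone \<Longrightarrow> Y \<in> psd_cone \<Longrightarrow> (\<And>v. quad X v \<le> quad Y v) \<Longrightarrow>
       loewner_close c0 (block X) (block Y)"
    and contract: "\<And>X Y c. X \<in> psd_cone \<Longrightarrow> Y \<in> psd_cone \<Longrightarrow> 0 \<le> c \<Longrightarrow> loewner_close c X Y \<Longrightarrow>
       loewner_close (\<rho> * c) (block X) (block Y)"
    using block_contracts by blast
  \<comment> \<open>The stream is generalised, because the run found first is the outermost one and
    the induction continues on what lies inside it.\<close>
  have *: "\<exists>n. \<forall>X\<in>psd_cone. \<forall>Y\<in>psd_cone. (\<forall>v. quad X v \<le> quad Y v) \<longrightarrow>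
      loewner_close (\<rho> ^ k * c0) (backward n s X) (backward n s Y)" if "regenerative s" for k s
    using that
  proof (induction k arbitrary: s)
    case 0
    then obtain m where m: "stake CARD('n) (sdrop m s) = replicate CARD('n) True"
      unfolding regenerative_def by blast
    \<comment> \<open>The \<open>+ 0\<close> brings the length into the form of
      \<open>backward_block\<close>, with an empty inner word.\<close>
    show ?case
    proof (intro exI[of _ "m + CARD('n) + 0"] ballI impI)
      fix X Y :: "real^'n^'n"
      assume "X \<in> psd_cone" "Y \<in> psd_cone" "\<forall>v. quad X v \<le> quad Y v"
      then show "loewner_close (\<rho> ^ 0 * c0) (backward (m + CARD('n) + 0) s X) (backward (m + CARD('n) + 0) s Y)"
        unfolding backward_block[OF m] unfolding backward_def
        using c0 by (auto intro!: foldr_loewner_close block_psd base)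
    qed
  next
    case (Suc k)
    from Suc.prems obtain m where m: "stake CARD('n) (sdrop m s) = replicate CARD('n) True"
      unfolding regenerative_def by blast
    obtain n where n: "\<forall>X\<in>psd_cone. \<forall>Y\<in>psd_cone. (\<forall>v. quad X v \<le> quad Y v) \<longrightarrow>
        loewner_close (\<rho> ^ k * c0) (backward n (sdrop (m + CARD('n)) s) X) (backward n (sdrop (m + CARD('n)) s) Y)"
      using Suc.IH[OF regenerative_sdrop[OF Suc.prems]] by blast
    show ?case
    proof (intro exI[of _ "m + CARD('n) + n"] ballI impI)
      fix X Y :: "real^'n^'n"
      assume XY: "X \<in> psd_cone" "Y \<in> psd_cone" "\<forall>v. quad X v \<le> quad Y v"
      let ?X = "backward n (sdrop (m + CARD('n)) s) X" and ?Y = "backward n (sdrop (m + CARD('n)) s) Y"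
      have "loewner_close (\<rho> * (\<rho> ^ k * c0)) (block ?X) (block ?Y)"
        using XY n \<rho> c0 by (intro contract backward_psd) auto
      then have "loewner_close (\<rho> * (\<rho> ^ k * c0)) (backward m s (block ?X)) (backward m s (block ?Y))"
        using XY \<rho> c0 unfolding backward_def[of m] by (intro foldr_loewner_close block_psd backward_psd) auto
      then show "loewner_close (\<rho> ^ Suc k * c0) (backward (m + CARD('n) + n) s X) (backward (m + CARD('n) + n) s Y)"
        unfolding backward_block[OF m] by (simp add: mult.assoc)
    qed
  qed
  have "(\<lambda>k. \<rho> ^ k * c0) \<longlonglongrightarrow> 0 * c0"
    using \<rho> by (intro tendsto_intros LIMSEQ_power_zero) auto
  then have "eventually (\<lambda>k. \<rho> ^ k * c0 < \<epsilon>) sequentially"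
    using \<open>\<epsilon> > 0\<close> by (intro order_tendstoD(2)) auto
  then obtain k where k: "\<rho> ^ k * c0 < \<epsilon>" by (auto simp: eventually_sequentially)
  obtain n where n: "\<And>X Y. X \<in> psd_cone \<Longrightarrow> Y \<in> psd_cone \<Longrightarrow> (\<And>v. quad X v \<le> quad Y v) \<Longrightarrow>
      loewner_close (\<rho> ^ k * c0) (backward n s X) (backward n s Y)"
    using *[OF assms(2), of k] by blast
  have "loewner_close \<epsilon> (backward n s X) (backward n s Y)"
    if XY: "X \<in> psd_cone" "Y \<in> psd_cone" "\<And>v. quad X v \<le> quad Y v" for X Y
    unfolding loewner_close_def
  proof (intro allI conjI)
    fix v
    have nv: "quad (backward n s X) v \<le> quad (backward n s Y) v"
        "quad (backward n s Y) v \<le> (1 + \<rho> ^ k * c0) * quad (backward n s X) v"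
      using n[OF XY] unfolding loewner_close_def by blast+
    show "quad (backward n s X) v \<le> quad (backward n s Y) v" by (rule nv)
    have "(1 + \<rho> ^ k * c0) * quad (backward n s X) v \<le> (1 + \<epsilon>) * quad (backward n s X) v"
      using k psd_cone_quad_nonneg[OF backward_psd[OF XY(1)]] by (intro mult_right_mono) auto
    then show "quad (backward n s Y) v \<le> (1 + \<epsilon>) * quad (backward n s X) v" using nv(2) by linarith
  qed
  then show thesis by (rule that)
qed

text \<open>The outer word alone may be unbounded on the cone. A run inside it first confines every
  input to a compact set, and continuity carries this through the outer word.\<close>

lemma regenerative_bounded:
  assumes "regenerative s"
  obtains n K where "\<And>X. X \<in> psd_cone \<Longrightarrow> norm (backward n s X) \<le> K"
proof -
  obtain m where m: "stake CARD('n) (sdrop m s) = replicate CARD('n) True"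
    using assms unfolding regenerative_def by blast
  obtain M where M: "\<And>X. X \<in> psd_cone \<Longrightarrow> norm (block X) \<le> M"
    using block_bounded by blast
  have "compact (psd_cone \<inter> cball (0 :: real^'n^'n) M)"
    by (intro closed_Int_compact closed_psd_cone compact_cball)
  then have "compact (backward m s ` (psd_cone \<inter> cball 0 M))"
    unfolding backward_def
    by (intro compact_continuous_image continuous_on_subset[OF continuous_on_foldr]) auto
  then have "bounded (backward m s ` (psd_cone \<inter> cball 0 M))" by (rule compact_imp_bounded)
  then obtain K where K: "\<And>Z. Z \<in> psd_cone \<inter> cball 0 M \<Longrightarrow> norm (backward m s Z) \<le> K"
    unfolding bounded_iff by blast
  have "norm (backward (m + CARD('n) + 0) s X) \<le> K" if "X \<in> psd_cone" for X
    unfolding backward_block[OF m]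
    using that M by (intro K) (auto intro!: block_psd backward_psd)
  then show thesis by (rule that)
qed

text \<open>Two arbitrary matrices are joined through \<open>0\<close>, the least element of the
  cone, at the cost of \<open>\<epsilon> / 2\<close> on each side.\<close>

lemma regenerative_coalescence:
  assumes "regenerative s" "\<epsilon> > 0"
  obtains n where "\<And>X Y. X \<in> psd_cone \<Longrightarrow> Y \<in> psd_cone \<Longrightarrow> dist (backward n s X) (backward n s Y) < \<epsilon>"
proof -
  obtain m K where K: "\<And>X. X \<in> psd_cone \<Longrightarrow> norm (backward m s X) \<le> K"
    using regenerative_bounded[OF assms(1)] by blast
  have "K \<ge> 0" using K[OF zero_psd] norm_ge_zero order_trans by blast
  define N where "N = K * CARD('n) * CARD('n) + 1"
  have "N > 0" using \<open>K \<ge> 0\<close> by (simp add: N_def add_nonneg_pos)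
  define \<delta> where "\<delta> = \<epsilon> / 2 / N"
  have "\<delta> > 0" using \<open>N > 0\<close> \<open>\<epsilon> > 0\<close> by (simp add: \<delta>_def)
  obtain n where n: "\<And>X Y. X \<in> psd_cone \<Longrightarrow> Y \<in> psd_cone \<Longrightarrow> (\<And>v. quad X v \<le> quad Y v) \<Longrightarrow>
    loewner_close \<delta> (backward n s X) (backward n s Y)"
    using regenerative_loewner_close[OF \<open>\<delta> > 0\<close> assms(1)] by blast
  have half: "dist (backward (n + m) s X) (backward (n + m) s 0) < \<epsilon> / 2" if X: "X \<in> psd_cone" for X
  proof -
    let ?X = "backward (n + m) s X" and ?O = "backward (n + m) s 0"
    have "loewner_close \<delta> ?O ?X"
      unfolding backward_add[of n m]
    proof (intro n backward_psd zero_psd X)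
      show "quad (backward m (sdrop n s) 0) v \<le> quad (backward m (sdrop n s) X) v" for v
        unfolding backward_def
        using psd_cone_quad_nonneg[OF X] by (intro foldr_mono zero_psd X) simp
    qed
    then have "norm (?X - ?O) \<le> \<delta> * norm ?O * CARD('n) * CARD('n)"
      using X \<open>\<delta> > 0\<close> by (intro norm_loewner_close backward_psd zero_psd) auto
    \<comment> \<open>The same word is cut the other way: its \<open>m\<close> outermost maps
      already enforce the bound \<open>K\<close>, while its \<open>n\<close> outermost maps enforce
      the ratio.\<close>
    also have "norm ?O \<le> K"
      using K[of "backward n (sdrop m s) 0"] backward_add[of m n s 0]
      by (simp add: backward_psd zero_psd add.commute)
    then have "\<delta> * norm ?O * CARD('n) * CARD('n) \<le> \<delta> * K * CARD('n) * CARD('n)"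
      using \<open>\<delta> > 0\<close> by (intro mult_right_mono mult_left_mono) auto
    also have "\<dots> < \<delta> * N" using \<open>\<delta> > 0\<close> by (simp add: N_def algebra_simps)
    also have "\<dots> = \<epsilon> / 2" using \<open>N > 0\<close> by (simp add: \<delta>_def)
    finally show ?thesis by (simp add: dist_norm)
  qed
  have "dist (backward (n + m) s X) (backward (n + m) s Y) < \<epsilon>" if "X \<in> psd_cone" "Y \<in> psd_cone" for X Y
    using half[OF that(1)] half[OF that(2)] by (rule dist_triangle_half_l)
  then show thesis by (rule that)
qed

section \<open>The pathwise limit\<close>

definition limit :: "bool stream \<Rightarrow> real^'n^'n" where
  "limit s = lim (\<lambda>n. backward n s 0)"

text \<open>Beyond the coalescence time \<open>n\<close> all iterates factor through the same
  \<open>n\<close> outermost maps, so they differ by less than \<open>\<epsilon>\<close>, whatever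
  their inner words and initial matrices.\<close>

lemma backward_tendsto_limit:
  assumes s: "regenerative s" and X: "X \<in> psd_cone"
  shows "(\<lambda>n. backward n s X) \<longlonglongrightarrow> limit s"
proof -
  have eventually_close: "\<exists>n. \<forall>k\<ge>n. \<forall>l\<ge>n. dist (backward k s Y) (backward l s Z) < \<epsilon>"
    if "\<epsilon> > 0" "Y \<in> psd_cone" "Z \<in> psd_cone" for \<epsilon> Y Z
  proof -
    obtain n where n: "\<And>X Y. X \<in> psd_cone \<Longrightarrow> Y \<in> psd_cone \<Longrightarrow> dist (backward n s X) (backward n s Y) < \<epsilon>"
      using regenerative_coalescence[OF s \<open>\<epsilon> > 0\<close>] by blast
    have "dist (backward k s Y) (backward l s Z) < \<epsilon>" if "k \<ge> n" "l \<ge> n" for k l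
      using n[of "backward (k - n) (sdrop n s) Y" "backward (l - n) (sdrop n s) Z"] that
        backward_add[of n "k - n" s Y] backward_add[of n "l - n" s Z] \<open>Y \<in> psd_cone\<close> \<open>Z \<in> psd_cone\<close>
      by (simp add: backward_psd)
    then show ?thesis by blast
  qed
  have "Cauchy (\<lambda>n. backward n s 0)"
    unfolding Cauchy_def using eventually_close[OF _ zero_psd zero_psd] by simp
  then have "(\<lambda>n. backward n s 0) \<longlonglongrightarrow> limit s"
    unfolding limit_def by (simp add: Cauchy_convergent convergent_LIMSEQ_iff[symmetric])
  moreover have "(\<lambda>n. dist (backward n s 0) (backward n s X)) \<longlonglongrightarrow> 0"
  proof (rule metric_LIMSEQ_I)
    fix r :: real assume "r > 0"
    then show "\<exists>no. \<forall>n\<ge>no. dist (dist (backward n s 0) (backward n s X)) 0 < r"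
      using eventually_close[OF _ zero_psd X, of r] by (simp add: dist_real_def) blast
  qed
  then have "(\<lambda>n. backward n s X - backward n s 0) \<longlonglongrightarrow> 0"
    by (simp add: dist_norm norm_minus_commute[of "backward _ s 0"] tendsto_norm_zero_iff)
  ultimately show ?thesis by (rule Lim_transform)
qed

lemma limit_psd: "regenerative s \<Longrightarrow> limit s \<in> psd_cone"
  by (rule closed_sequentially[OF closed_psd_cone _ backward_tendsto_limit[OF _ zero_psd]])
    (auto intro: backward_psd zero_psd)

text \<open>Self-similarity of the limit: the source of invariance and of the approximation by
  prefixes.\<close>

lemma limit_eq_backward:
  assumes s: "regenerative s"
  shows "limit s = backward n s (limit (sdrop n s))"
proof -
  have s': "regenerative (sdrop n s)" using s by (rule regenerative_sdrop)
  have "(\<lambda>k. backward n s (backward k (sdrop n s) 0)) \<longlonglongrightarrow> backward n s (limit (sdrop n s))"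
    unfolding backward_def[of n]
    by (rule continuous_on_tendsto_compose[OF continuous_on_foldr backward_tendsto_limit[OF s' zero_psd]])
      (auto intro!: always_eventually limit_psd s' backward_psd zero_psd)
  then have "(\<lambda>k. backward (k + n) s 0) \<longlonglongrightarrow> backward n s (limit (sdrop n s))"
    by (simp add: backward_add add.commute[of _ n])
  moreover have "(\<lambda>k. backward (k + n) s 0) \<longlonglongrightarrow> limit s"
    by (rule LIMSEQ_ignore_initial_segment[OF backward_tendsto_limit[OF s zero_psd]])
  ultimately show ?thesis by (rule LIMSEQ_unique[rotated])
qed

section \<open>The fixed point as the limit along uninterrupted arrivals\<close>

lemma stake_sconst: "stake n (sconst x) = replicate n x"
  by (simp add: list_eq_iff_nth_eq id_funpow)

lemma sdrop_sconst: "sdrop n (sconst x) = sconst x"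
  by (simp add: sdrop_siterate id_funpow)

lemma regenerative_sconst: "regenerative (sconst True)"
  unfolding regenerative_def sdrop_sconst stake_sconst by blast

lemma backward_sconst: "backward n (sconst True) = f True ^^ n"
  by (simp only: backward_def stake_sconst foldr_replicate)

abbreviation P_star where "P_star \<equiv> riccati_fixpoint A C Q R"

text \<open>The stream of arrivals is regenerative, so existence is convergence along it. A fixed
  point makes the backward sequence constant, which gives uniqueness and thereby determines the
  \<open>THE\<close> in \<open>riccati_fixpoint\<close>.\<close>

lemma P_star_eq_limit: "P_star = limit (sconst True)"
  and P_star_psd: "P_star \<in> psd_cone"
  and riccati_closed_P_star: "f True P_star = P_star"
proof -
  let ?P = "limit (sconst True)"
  have P: "?P \<in> psd_cone" by (rule limit_psd[OF regenerative_sconst])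
  have fP: "f True ?P = ?P"
    using limit_eq_backward[OF regenerative_sconst, of 1] unfolding backward_sconst sdrop_sconst by simp
  have uniq: "Y = ?P" if Y: "Y \<in> psd_cone" "f True Y = Y" for Y
  proof -
    have "backward n (sconst True) Y = Y" for n
      unfolding backward_sconst by (induction n) (simp_all add: Y(2))
    then have "(\<lambda>n. Y) \<longlonglongrightarrow> ?P"
      using backward_tendsto_limit[OF regenerative_sconst Y(1)] by (simp only:)
    then show ?thesis by (simp add: LIMSEQ_const_iff)
  qed
  have closed: "f True = riccati_closed A C Q R" by (simp add: riccati_map_def fun_eq_iff)
  show "P_star = ?P"
    unfolding riccati_fixpoint_def closed[symmetric]
    by (rule the_equality) (use P fP uniq in blast)+
  then show "P_star \<in> psd_cone" "f True P_star = P_star" using P fP by (simp_all only:)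
qed

text \<open>Replacing an arrival by a loss can only increase the form, as the zero control is among
  the candidates of the closed loop. By monotonicity the smallest word is the one of arrivals, and
  it fixes \<open>P_star\<close>.\<close>

lemma P_star_le_foldr: "quad P_star v \<le> quad (foldr f w P_star) v"
proof (induction w arbitrary: v)
  case (Cons i w)
  let ?Y = "foldr f w P_star"
  have Y: "?Y \<in> psd_cone" by (intro foldr_psd P_star_psd)
  have "quad P_star v = quad (f True P_star) v" by (simp add: riccati_closed_P_star)
  also have "\<dots> \<le> quad (f True ?Y) v" by (intro riccati_map_mono P_star_psd Y Cons)
  also have "\<dots> \<le> quad (f i ?Y) v"
    using riccati_map_le_open[OF Y, where i = True and v = v] quad_riccati_open[where X = ?Y and v = v] by (cases i) auto
  finally show ?case by simp
qed simp

lemma P_star_le_limit: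
  assumes "regenerative s"
  shows "P_star \<preceq> limit s"
proof -
  have "limit s \<in> {Y \<in> psd_cone. P_star \<preceq> Y}"
  proof (rule closed_sequentially[OF closed_loewner_ge _ backward_tendsto_limit[OF assms P_star_psd]])
    show "P_star \<in> psd_cone" by (rule P_star_psd)
    show "backward n s P_star \<in> {Y \<in> psd_cone. P_star \<preceq> Y}" for n
      using loewner_le_iff[OF P_star_psd backward_psd[OF P_star_psd], of n s]
        P_star_le_foldr[of _ "stake n s"] backward_psd[OF P_star_psd, of n s]
      unfolding backward_def by blast
  qed
  then show ?thesis by simp
qed

lemma regenerative_sdropD: "regenerative (sdrop k s) \<Longrightarrow> regenerative s"
  unfolding regenerative_def
proof (intro allI)
  fix n
  assume "\<forall>n. \<exists>m\<ge>n. stake CARD('n) (sdrop m (sdrop k s)) = replicate CARD('n) True"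
  then obtain m where "m \<ge> n" "stake CARD('n) (sdrop m (sdrop k s)) = replicate CARD('n) True" by blast
  then show "\<exists>m\<ge>n. stake CARD('n) (sdrop m s) = replicate CARD('n) True"
    by (intro exI[of _ "k + m"]) (simp add: sdrop_add)
qed

text \<open>Coalescence in terms of open sets: a long prefix alone sends the whole cone into
  \<open>T\<close>. The comparison with other invariant laws and both halves of the support theorem
  rest on this.\<close>

lemma backward_eventually_in_open:
  assumes s: "regenerative s" and T: "open T" "limit s \<in> T"
  shows "\<forall>\<^sub>F n in sequentially. \<forall>X\<in>psd_cone. backward n s X \<in> T"
proof -
  obtain e where e: "e > 0" "ball (limit s) e \<subseteq> T" using T by (auto simp: open_contains_ball)
  obtain n where n: "\<And>X Y. X \<in> psd_cone \<Longrightarrow> Y \<in> psd_cone \<Longrightarrow> dist (backward n s X) (backward n s Y) < e"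
    using regenerative_coalescence[OF s e(1)] by blast
  have "backward k s X \<in> T" if "k \<ge> n" "X \<in> psd_cone" for k X
  proof -
    have "dist (backward n s (limit (sdrop n s))) (backward n s (backward (k - n) (sdrop n s) X)) < e"
      by (intro n limit_psd regenerative_sdrop s backward_psd that)
    then have "dist (limit s) (backward k s X) < e"
      using limit_eq_backward[OF s, of n] backward_add[of n "k - n" s X] that(1) by simp
    then show ?thesis using e(2) by (auto simp: subset_iff)
  qed
  then show ?thesis unfolding eventually_sequentially by blast
qed

lemma limit_SCons:
  assumes "regenerative s"
  shows "limit (i ## s) = f i (limit s)"
proof -
  have "regenerative (i ## s)" using regenerative_sdropD[of 1 "i ## s"] assms by simp
  then show ?thesis using limit_eq_backward[of "i ## s" 1] by (simp add: backward_def)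
qed

end

lemma prod_list_eq_prod_nth: "prod_list xs = (\<Prod>i<length xs. xs ! i :: 'a :: comm_monoid_mult)"
  by (induction xs) (simp_all add: prod.lessThan_Suc_shift del: prod.lessThan_Suc)

section \<open>Bernoulli streams\<close>

locale riccati_random = riccati A Q C R
  for A Q :: "real^'n^'n" and C :: "real^'n^'m" and R :: "real^'m^'m" +
  fixes g :: real
  assumes g_pos: "0 < g" and g_le_1: "g \<le> 1"
begin

abbreviation coin where "coin \<equiv> measure_pmf (bernoulli_pmf g)"

abbreviation coins where "coins \<equiv> stream_space coin"

definition word_prob :: "bool list \<Rightarrow> real" where
  "word_prob w = prod_list (map (pmf (bernoulli_pmf g)) w)"

lemma sets_coins: "sets coins = sets (stream_space (count_space UNIV))"
  by (rule sets_stream_space_cong) simp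

lemma space_coins: "space coins = UNIV"
  by (simp add: space_stream_space)

sublocale coins: prob_space coins
  by (rule prob_space.prob_space_stream_space[OF prob_space_measure_pmf])

lemma measurable_stake_coins [measurable]: "stake n \<in> coins \<rightarrow>\<^sub>M count_space UNIV"
  by (subst measurable_cong_sets[OF sets_coins refl]) (rule measurable_stake)

lemma measurable_SCons_coins [measurable]: "(##) i \<in> coins \<rightarrow>\<^sub>M coins"
  by (rule measurable_Stream) auto

lemma word_prob_nonneg: "0 \<le> word_prob w"
  unfolding word_prob_def by (induction w) auto

lemma word_prob_pos:
  assumes "g < 1"
  shows "0 < word_prob w"
proof (induction w)
  case (Cons a w)
  then show ?case using g_pos assms by (cases a) (simp_all add: word_prob_def)
qed (simp add: word_prob_def)

lemma pred_coins: "B \<in> sets coins \<Longrightarrow> {s. sdrop n s \<in> B} \<in> sets coins"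
  using measurable_sets[OF measurable_sdrop, of B coin n] by (simp add: space_coins vimage_def)

lemma pred_stake_coins: "{s. stake n s = w} \<in> sets coins"
  using measurable_sets[OF measurable_stake_coins, of "{w}" n] by (simp add: space_coins vimage_def)

lemma emeasure_cylinder:
  assumes B: "B \<in> sets coins"
  shows "emeasure coins {s. stake (length w) s = w \<and> sdrop (length w) s \<in> B} = word_prob w * emeasure coins B"
proof (induction w)
  case Nil
  then show ?case by (simp add: word_prob_def)
next
  case (Cons a w)
  let ?E = "\<lambda>w. {s. stake (length w) s = w \<and> sdrop (length w) s \<in> B}"
  have E: "?E w \<in> sets coins" for w
    using sets.Int[OF pred_stake_coins pred_coins[OF B], of "length w" w "length w"]
    by (simp add: Collect_conj_eq)
  have "emeasure coins (?E (a # w)) = (\<integral>\<^sup>+t. emeasure coins {x \<in> space coins. t ## x \<in> ?E (a # w)} \<partial>coin)"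
    by (rule prob_space.emeasure_stream_space[OF prob_space_measure_pmf E])
  also have "\<dots> = (\<integral>\<^sup>+t. emeasure coins (?E w) * indicator {a} t \<partial>coin)"
    by (intro nn_integral_cong) (auto simp: space_coins indicator_def)
  also have "\<dots> = emeasure coins (?E w) * pmf (bernoulli_pmf g) a"
    by (subst nn_integral_cmult_indicator) (auto simp: emeasure_pmf_single)
  also have "\<dots> = word_prob (a # w) * emeasure coins B"
    unfolding Cons.IH using word_prob_nonneg[of w]
    by (simp add: word_prob_def ennreal_mult' mult_ac)
  finally show ?case .
qed

lemma emeasure_stake: "emeasure coins {s. stake (length w) s = w} = word_prob w"
  using emeasure_cylinder[of UNIV w] coins.emeasure_space_1 sets.top[of coins]
  by (simp add: space_coins)

lemma emeasure_sdrop: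
  assumes B: "B \<in> sets coins"
  shows "emeasure coins {s. sdrop n s \<in> B} = emeasure coins B"
proof (induction n)
  case (Suc n)
  have "emeasure coins {s. sdrop (Suc n) s \<in> B}
      = (\<integral>\<^sup>+t. emeasure coins {x \<in> space coins. t ## x \<in> {s. sdrop (Suc n) s \<in> B}} \<partial>coin)"
    by (rule prob_space.emeasure_stream_space[OF prob_space_measure_pmf pred_coins[OF B]])
  also have "\<dots> = emeasure coins B"
    by (simp add: space_coins Suc measure_pmf.emeasure_space_1)
  finally show ?case .
qed simp

text \<open>Shift invariance is played against independence: a stream in \<open>E\<close> has its
  tail in \<open>E\<close> but does not begin with a run, so the measure \<open>p\<close> of
  \<open>E\<close> satisfies \<open>p \<le> p - word_prob ?ones * p\<close>.\<close>

lemma AE_regenerative: "AE s in coins. regenerative s"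
proof -
  let ?ones = "replicate CARD('n) True"
  define E where "E = {s. \<forall>m. stake CARD('n) (sdrop m s) \<noteq> ?ones}"
  have "E = space coins - (\<Union>m. {s. sdrop m s \<in> {s. stake CARD('n) s = ?ones}})"
    by (auto simp: E_def space_coins)
  also have "\<dots> \<in> sets coins"
  proof (intro sets.Diff sets.top sets.countable_UN)
    have "{s. sdrop m s \<in> {s. stake CARD('n) s = ?ones}} \<in> sets coins" for m
      by (intro pred_coins pred_stake_coins)
    then show "range (\<lambda>m. {s. sdrop m s \<in> {s. stake CARD('n) s = ?ones}}) \<subseteq> sets coins"
      by (rule image_subsetI)
  qed
  finally have E: "E \<in> sets coins" .
  let ?hit = "{s. stake CARD('n) s = ?ones \<and> sdrop CARD('n) s \<in> E}"
  have hit: "?hit \<in> sets coins"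
    using sets.Int[OF pred_stake_coins pred_coins[OF E], of "CARD('n)" ?ones "CARD('n)"]
    by (simp add: Collect_conj_eq)
  have "E \<subseteq> {s. sdrop CARD('n) s \<in> E} - ?hit"
    unfolding E_def by (auto simp: sdrop_add dest: spec[of _ "0 :: nat"])
  then have "measure coins E \<le> measure coins ({s. sdrop CARD('n) s \<in> E} - ?hit)"
    using E hit by (intro coins.finite_measure_mono sets.Diff pred_coins)
  also have "\<dots> = measure coins {s. sdrop CARD('n) s \<in> E} - measure coins ?hit"
    using E hit by (intro coins.finite_measure_Diff pred_coins) auto
  also have "measure coins {s. sdrop CARD('n) s \<in> E} = measure coins E"
    by (simp add: measure_def emeasure_sdrop[OF E])
  also have "measure coins ?hit = word_prob ?ones * measure coins E"
    using emeasure_cylinder[OF E, of ?ones] word_prob_nonneg[of ?ones]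
    by (simp add: measure_def enn2real_mult)
  finally have "word_prob ?ones * measure coins E \<le> 0" by simp
  moreover have "word_prob ?ones > 0"
    using g_pos g_le_1 by (simp add: word_prob_def prod_list_replicate)
  ultimately have "measure coins E = 0"
    using measure_nonneg[of coins E] by (simp add: mult_le_0_iff)
  \<comment> \<open>The complement of \<open>E\<close> guarantees only one run. Applying the null
    set to every tail upgrades this to runs at arbitrarily late positions.\<close>
  then have "emeasure coins {s. sdrop n s \<in> E} = 0" for n
    unfolding emeasure_sdrop[OF E] by (simp add: coins.emeasure_eq_measure)
  then have "AE s in coins. sdrop n s \<notin> E" for n
    using pred_coins[OF E, of n] by (intro AE_I[of _ _ "{s. sdrop n s \<in> E}"]) auto
  then have "AE s in coins. \<forall>n. sdrop n s \<notin> E"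
    by (simp add: AE_all_countable)
  then show ?thesis
  proof eventually_elim
    case (elim s)
    show ?case
      unfolding regenerative_def
    proof
      fix n
      obtain m where "stake CARD('n) (sdrop m (sdrop n s)) = ?ones"
        using elim[rule_format, of n] unfolding E_def by blast
      then show "\<exists>m\<ge>n. stake CARD('n) (sdrop m s) = ?ones"
        by (intro exI[of _ "n + m"]) (simp add: sdrop_add)
    qed
  qed
qed

section \<open>The invariant distribution\<close>

lemma measurable_stake_fun: "(\<lambda>s. h (stake n s)) \<in> borel_measurable coins"
  by (rule measurable_compose[OF measurable_stake_coins]) simp

lemma measurable_backward: "X \<in> psd_cone \<Longrightarrow> (\<lambda>s. backward n s X) \<in> coins \<rightarrow>\<^sub>M psd_borel"
  unfolding measurable_psd_borel_iff
  by (auto intro!: backward_psd) (simp add: backward_def measurable_stake_fun)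

text \<open>The limit need not exist off the almost sure event; the value there is irrelevant but has
  to stay in the cone.\<close>

definition psd_limit :: "bool stream \<Rightarrow> real^'n^'n" where
  "psd_limit s = (if limit s \<in> psd_cone then limit s else 0)"

definition stationary :: "(real^'n^'n) measure" where
  "stationary = distr coins psd_borel psd_limit"

lemma psd_limit_eq: "regenerative s \<Longrightarrow> psd_limit s = limit s"
  by (simp add: psd_limit_def limit_psd)

lemma measurable_psd_limit [measurable]: "psd_limit \<in> coins \<rightarrow>\<^sub>M psd_borel"
proof -
  have [measurable]: "limit \<in> borel_measurable coins"
    unfolding limit_def[abs_def]
    using measurable_backward[OF zero_psd] unfolding measurable_psd_borel_iff
    by (intro borel_measurable_lim_metric) auto
  have [measurable]: "(psd_cone :: (real^'n^'n) set) \<in> sets borel"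
    by (intro borel_closed closed_psd_cone)
  have "psd_limit \<in> borel_measurable coins"
    unfolding psd_limit_def[abs_def] by measurable
  then show ?thesis
    unfolding measurable_psd_borel_iff by (auto simp: psd_limit_def zero_psd)
qed

lemma prob_space_stationary: "prob_space stationary"
  unfolding stationary_def by (rule coins.prob_space_distr[OF measurable_psd_limit])

lemma sets_stationary: "sets stationary = sets psd_borel"
  by (simp add: stationary_def)

lemma emeasure_stationary:
  "B \<in> sets psd_borel \<Longrightarrow> emeasure stationary B = emeasure coins {s. psd_limit s \<in> B}"
  unfolding stationary_def by (subst emeasure_distr) (auto simp: space_coins vimage_def)

lemma sets_psd_limit: "B \<in> sets psd_borel \<Longrightarrow> {s. psd_limit s \<in> B} \<in> sets coins"
  using measurable_sets[OF measurable_psd_limit, of B] by (simp add: space_coins vimage_def)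

lemma measurable_riccati_map [measurable]: "f i \<in> psd_borel \<rightarrow>\<^sub>M psd_borel"
  unfolding measurable_psd_borel_iff space_psd_borel
  by (auto intro!: measurable_psd_borel_continuous continuous_on_riccati_map riccati_map_psd)

lemma sets_riccati_preimage: "B \<in> sets psd_borel \<Longrightarrow> {X \<in> psd_cone. f i X \<in> B} \<in> sets psd_borel"
  using measurable_sets[OF measurable_riccati_map, of B i]
  by (simp add: space_psd_borel vimage_def Int_def conj_commute)

lemma nn_integral_coin: "(\<integral>\<^sup>+i. h i \<partial>coin) = h True * g + h False * (1 - g)"
  using g_pos g_le_1 by (subst nn_integral_bernoulli_pmf) auto

lemma nn_integral_kernel:
  assumes \<nu>: "sets \<nu> = sets psd_borel" and B: "B \<in> sets psd_borel"
  shows "(\<integral>\<^sup>+X. emeasure (riccati_kernel A C Q R g X) B \<partial>\<nu>)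
    = (\<integral>\<^sup>+i. emeasure \<nu> {X \<in> psd_cone. f i X \<in> B} \<partial>coin)"
proof -
  have space: "space \<nu> = psd_cone"
    using sets_eq_imp_space_eq[OF \<nu>] by (simp add: space_psd_borel)
  have pre: "{X \<in> psd_cone. f i X \<in> B} \<in> sets \<nu>" for i
    using sets_riccati_preimage[OF B] \<nu> by simp
  have total: "ennreal g + ennreal (1 - g) = 1"
    using g_pos g_le_1 by (simp flip: ennreal_plus)
  have "(\<integral>\<^sup>+X. emeasure (riccati_kernel A C Q R g X) B \<partial>\<nu>)
      = (\<integral>\<^sup>+X. indicator {X \<in> psd_cone. f True X \<in> B} X * ennreal g
             + indicator {X \<in> psd_cone. f False X \<in> B} X * ennreal (1 - g) \<partial>\<nu>)"
  proof (rule nn_integral_cong)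
    fix X assume "X \<in> space \<nu>"
    then have X: "X \<in> psd_cone" by (simp add: space)
    have "(\<lambda>i. f i X) \<in> coin \<rightarrow>\<^sub>M psd_borel"
      using X by (auto simp: space_psd_borel intro: riccati_map_psd)
    then have "emeasure (riccati_kernel A C Q R g X) B = (\<integral>\<^sup>+i. indicator {i. f i X \<in> B} i \<partial>coin)"
      unfolding riccati_kernel_def by (subst emeasure_distr[OF _ B]) (auto simp: vimage_def)
    then show "emeasure (riccati_kernel A C Q R g X) B
      = indicator {X \<in> psd_cone. f True X \<in> B} X * ennreal g + indicator {X \<in> psd_cone. f False X \<in> B} X * ennreal (1 - g)"
      using X total unfolding nn_integral_coin by (simp add: indicator_def)
  qed
  also have "\<dots> = emeasure \<nu> {X \<in> psd_cone. f True X \<in> B} * g + emeasure \<nu> {X \<in> psd_cone. f False X \<in> B} * (1 - g)"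
    using pre by (subst nn_integral_add) (auto simp: nn_integral_multc)
  finally show ?thesis by (simp add: nn_integral_coin)
qed

text \<open>Prepending an independent coin leaves the law of the stream unchanged and applies
  \<open>f i\<close> to the limit.\<close>

lemma riccati_invariant_stationary: "riccati_invariant A C Q R g stationary"
  unfolding riccati_invariant_def
proof (intro conjI ballI prob_space_stationary sets_stationary)
  fix B :: "(real^'n^'n) set" assume B: "B \<in> sets psd_borel"
  have step: "emeasure coins {s. psd_limit (i ## s) \<in> B} = emeasure stationary {X \<in> psd_cone. f i X \<in> B}" for i
    unfolding emeasure_stationary[OF sets_riccati_preimage[OF B]]
  proof (rule emeasure_eq_AE)
    show "AE s in coins. s \<in> {s. psd_limit (i ## s) \<in> B} \<longleftrightarrow> s \<in> {s. psd_limit s \<in> {X \<in> psd_cone. f i X \<in> B}}"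
      using AE_regenerative
    proof eventually_elim
      case (elim s)
      then have "regenerative (i ## s)" using regenerative_sdropD[of 1 "i ## s"] by simp
      then show ?case using elim by (simp add: psd_limit_eq limit_SCons limit_psd)
    qed
    show "{s. psd_limit (i ## s) \<in> B} \<in> sets coins"
      using measurable_sets[OF measurable_SCons_coins sets_psd_limit[OF B]]
      by (simp add: space_coins vimage_def)
    show "{s. psd_limit s \<in> {X \<in> psd_cone. f i X \<in> B}} \<in> sets coins"
      by (rule sets_psd_limit[OF sets_riccati_preimage[OF B]])
  qed
  have "emeasure stationary B = (\<integral>\<^sup>+i. emeasure coins {s \<in> space coins. i ## s \<in> {s. psd_limit s \<in> B}} \<partial>coin)"
    unfolding emeasure_stationary[OF B]
    by (rule prob_space.emeasure_stream_space[OF prob_space_measure_pmf sets_psd_limit[OF B]])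
  also have "\<dots> = (\<integral>\<^sup>+X. emeasure (riccati_kernel A C Q R g X) B \<partial>stationary)"
    by (simp add: space_coins step nn_integral_kernel[OF sets_stationary B])
  finally show "emeasure stationary B = (\<integral>\<^sup>+X. emeasure (riccati_kernel A C Q R g X) B \<partial>stationary)" .
qed

text \<open>An initial matrix with law \<open>\<nu>\<close>, independent of the coins, keeps this
  law under \<open>n\<close> backward steps. \<open>B\<close> varies in the induction, since
  removing the outermost coin replaces it by a preimage under \<open>f i\<close>.\<close>

lemma invariant_emeasure_backward:
  assumes \<nu>: "riccati_invariant A C Q R g \<nu>" and B: "B \<in> sets psd_borel"
  shows "emeasure \<nu> B = (\<integral>\<^sup>+s. emeasure \<nu> {X \<in> psd_cone. backward n s X \<in> B} \<partial>coins)"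
  using B
proof (induction n arbitrary: B)
  case 0
  then have "{X \<in> psd_cone. X \<in> B} = B" by (auto simp: sets_psd_borel_iff)
  then show ?case by (simp add: backward_def coins.emeasure_space_1)
next
  case (Suc n)
  have sets: "sets \<nu> = sets psd_borel" using \<nu> by (simp add: riccati_invariant_def)
  have cons: "{X \<in> psd_cone. backward (Suc n) (i ## s) X \<in> B}
      = {X \<in> psd_cone. backward n s X \<in> {X \<in> psd_cone. f i X \<in> B}}" for i s
    by (auto simp: backward_def foldr_psd)
  have "emeasure \<nu> B = (\<integral>\<^sup>+i. emeasure \<nu> {X \<in> psd_cone. f i X \<in> B} \<partial>coin)"
    using \<nu> Suc.prems nn_integral_kernel[OF sets Suc.prems] unfolding riccati_invariant_def by simp
  also have "\<dots> = (\<integral>\<^sup>+i. \<integral>\<^sup>+s. emeasure \<nu> {X \<in> psd_cone. backward (Suc n) (i ## s) X \<in> B} \<partial>coins \<partial>coin)"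
    unfolding cons using Suc.IH[OF sets_riccati_preimage[OF Suc.prems]] by simp
  also have "\<dots> = (\<integral>\<^sup>+s. emeasure \<nu> {X \<in> psd_cone. backward (Suc n) s X \<in> B} \<partial>coins)"
    unfolding backward_def by (rule prob_space.nn_integral_stream_space[OF prob_space_measure_pmf measurable_stake_fun, symmetric])
  finally show ?case .
qed

text \<open>Where the limit lies in \<open>T\<close>, the integrand of
  \<open>invariant_emeasure_backward\<close> is eventually \<open>1\<close>, however
  \<open>\<nu>\<close> is spread over the cone. Fatou's lemma then suffices, because the integrals
  do not depend on \<open>n\<close>.\<close>

lemma stationary_le_invariant_open:
  assumes \<nu>: "riccati_invariant A C Q R g \<nu>" and T: "open T"
  shows "emeasure stationary (psd_cone \<inter> T) \<le> emeasure \<nu> (psd_cone \<inter> T)"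
proof -
  let ?U = "psd_cone \<inter> T" and ?h = "\<lambda>n s. emeasure \<nu> {X \<in> psd_cone. backward n s X \<in> psd_cone \<inter> T}"
  have sets: "sets \<nu> = sets psd_borel" and "prob_space \<nu>" using \<nu> by (simp_all add: riccati_invariant_def)
  then have one: "emeasure \<nu> psd_cone = 1"
    using prob_space.emeasure_space_1 sets_eq_imp_space_eq[OF sets] by (metis space_psd_borel)
  have U: "?U \<in> sets psd_borel"
    using T by (simp add: sets_psd_borel_iff borel_closed closed_psd_cone)
  have "emeasure stationary ?U = (\<integral>\<^sup>+s. indicator {s. psd_limit s \<in> ?U} s \<partial>coins)"
    unfolding emeasure_stationary[OF U] using sets_psd_limit[OF U] by (rule nn_integral_indicator[symmetric])
  also have "\<dots> \<le> (\<integral>\<^sup>+s. liminf (\<lambda>n. ?h n s) \<partial>coins)"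
  proof (rule nn_integral_mono_AE)
    show "AE s in coins. indicator {s. psd_limit s \<in> ?U} s \<le> liminf (\<lambda>n. ?h n s)"
      using AE_regenerative
    proof eventually_elim
      case (elim s)
      show ?case
      proof (cases "limit s \<in> T")
        case True
        then have "\<forall>\<^sub>F n in sequentially. \<forall>X\<in>psd_cone. backward n s X \<in> T"
          by (intro backward_eventually_in_open elim T)
        then have "\<forall>\<^sub>F n in sequentially. ?h n s = 1"
        proof eventually_elim
          case (elim n)
          then have "{X \<in> psd_cone. backward n s X \<in> ?U} = psd_cone" by (auto intro: backward_psd)
          then show ?case by (simp add: one)
        qed
        then have "1 \<le> liminf (\<lambda>n. ?h n s)"
          by (intro Liminf_bounded) (auto elim: eventually_mono)
        then show ?thesis by (cases "psd_limit s \<in> ?U") simp_all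
      next
        case False
        then show ?thesis using elim by (simp add: psd_limit_eq)
      qed
    qed
  qed
  also have "\<dots> \<le> liminf (\<lambda>n. \<integral>\<^sup>+s. ?h n s \<partial>coins)"
    unfolding backward_def by (intro nn_integral_liminf measurable_stake_fun)
  also have "\<dots> = emeasure \<nu> ?U"
    unfolding invariant_emeasure_backward[OF \<nu> U, symmetric] by (simp add: Liminf_const)
  finally show ?thesis .
qed

text \<open>One inequality is enough: outer regularity carries it from open to Borel sets, and for
  probability measures complements turn it into equality.\<close>

lemma invariant_unique:
  assumes \<nu>: "riccati_invariant A C Q R g \<nu>"
  shows "\<nu> = stationary"
proof -
  \<comment> \<open>Outer regularity concerns Borel measures on the full matrix space, so measures
    on the cone are pushed forward by inclusion.\<close>
  define ext :: "(real^'n^'n) measure \<Rightarrow> (real^'n^'n) measure" where "ext = (\<lambda>\<kappa>. distr \<kappa> borel (\<lambda>X. X))"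
  have sets: "sets \<nu> = sets psd_borel" and "prob_space \<nu>" using \<nu> by (simp_all add: riccati_invariant_def)
  have id: "(\<lambda>X. X) \<in> borel_measurable \<kappa>" if "sets \<kappa> = sets psd_borel" for \<kappa> :: "(real^'n^'n) measure"
    by (subst measurable_cong_sets[OF that refl]) (auto intro: measurable_psd_borel_continuous)
  have ext: "emeasure (ext \<kappa>) B = emeasure \<kappa> (psd_cone \<inter> B)"
    if "sets \<kappa> = sets psd_borel" "B \<in> sets borel" for \<kappa> B
    using sets_eq_imp_space_eq[OF that(1)] unfolding ext_def
    by (subst emeasure_distr[OF id[OF that(1)] that(2)]) (simp add: space_psd_borel Int_commute)
  have sets_ext: "sets (ext \<kappa>) = sets borel" for \<kappa>
    by (simp add: ext_def)
  interpret \<mu>': prob_space "ext stationary"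
    unfolding ext_def by (intro prob_space.prob_space_distr prob_space_stationary id sets_stationary)
  interpret \<nu>': prob_space "ext \<nu>"
    unfolding ext_def by (intro prob_space.prob_space_distr \<open>prob_space \<nu>\<close> id sets)
  have le: "emeasure (ext stationary) B \<le> emeasure (ext \<nu>) B" if "B \<in> sets borel" for B
  proof -
    have "emeasure (ext stationary) B = (INF T\<in>{T. B \<subseteq> T \<and> open T}. emeasure (ext stationary) T)"
      by (intro outer_regular that) (simp_all add: sets_ext \<mu>'.emeasure_space_1)
    also have "\<dots> \<le> (INF T\<in>{T. B \<subseteq> T \<and> open T}. emeasure (ext \<nu>) T)"
      using stationary_le_invariant_open[OF \<nu>]
      by (intro INF_mono) (auto simp: ext sets sets_stationary intro!: bexI)
    also have "\<dots> = emeasure (ext \<nu>) B"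
      by (intro outer_regular[symmetric] that) (simp_all add: sets_ext \<nu>'.emeasure_space_1)
    finally show ?thesis .
  qed
  have eq: "emeasure (ext stationary) B = emeasure (ext \<nu>) B" if B: "B \<in> sets borel" for B
  proof -
    have "\<mu>'.prob B \<le> \<nu>'.prob B"
      using le[OF B] by (simp add: \<mu>'.emeasure_eq_measure \<nu>'.emeasure_eq_measure)
    moreover have "\<mu>'.prob (- B) \<le> \<nu>'.prob (- B)"
      using le[of "- B"] B by (simp add: \<mu>'.emeasure_eq_measure \<nu>'.emeasure_eq_measure)
    then have "1 - \<mu>'.prob B \<le> 1 - \<nu>'.prob B"
      using \<mu>'.prob_compl[of B] \<nu>'.prob_compl[of B] B by (simp add: ext_def Compl_eq_Diff_UNIV)
    ultimately show ?thesis by (simp add: \<mu>'.emeasure_eq_measure \<nu>'.emeasure_eq_measure)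
  qed
  show ?thesis
  proof (rule measure_eqI)
    show "sets \<nu> = sets stationary" by (simp add: sets sets_stationary)
    fix B assume "B \<in> sets \<nu>"
    then have B: "B \<subseteq> psd_cone" "B \<in> sets borel" by (simp_all add: sets sets_psd_borel_iff)
    then have "psd_cone \<inter> B = B" by blast
    then show "emeasure \<nu> B = emeasure stationary B"
      using eq[OF B(2)] ext[OF sets B(2)] ext[OF sets_stationary B(2)] by simp
  qed
qed

text \<open>Almost sure convergence of the backward iterates reduces this to dominated convergence,
  with a bound of \<open>h\<close> as the dominating constant.\<close>

lemma weak_conv_backward:
  assumes P0: "P0 \<in> psd_cone"
  shows "psd_weak_conv (\<lambda>t. distr coins psd_borel (\<lambda>s. backward t s P0)) stationary"
  unfolding psd_weak_conv_def
proof (intro allI impI, elim conjE)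
  fix h :: "real^'n^'n \<Rightarrow> real"
  assume h: "continuous_map psd.mtopology euclideanreal h" and "bounded (h ` psd_cone)"
  then obtain K where K: "\<And>X. X \<in> psd_cone \<Longrightarrow> norm (h X) \<le> K" by (auto simp: bounded_iff)
  have cont: "continuous_on psd_cone h" using h by (simp add: psd_mtopology)
  have hm: "h \<in> borel_measurable psd_borel" by (rule measurable_psd_borel_continuous[OF cont])
  have "(\<lambda>t. integral\<^sup>L coins (\<lambda>s. h (backward t s P0))) \<longlonglongrightarrow> integral\<^sup>L coins (\<lambda>s. h (psd_limit s))"
  proof (rule integral_dominated_convergence[where w = "\<lambda>_. K"])
    show "(\<lambda>s. h (psd_limit s)) \<in> borel_measurable coins"
      by (rule measurable_compose[OF measurable_psd_limit hm])
    show "(\<lambda>s. h (backward t s P0)) \<in> borel_measurable coins" for t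
      by (rule measurable_compose[OF measurable_backward[OF P0] hm])
    show "integrable coins (\<lambda>_. K)" by simp
    show "AE s in coins. norm (h (backward t s P0)) \<le> K" for t
      by (intro AE_I2 K backward_psd P0)
    show "AE s in coins. (\<lambda>t. h (backward t s P0)) \<longlonglongrightarrow> h (psd_limit s)"
      using AE_regenerative
    proof eventually_elim
      case (elim s)
      have "(\<lambda>t. h (backward t s P0)) \<longlonglongrightarrow> h (limit s)"
        by (rule continuous_on_tendsto_compose[OF cont backward_tendsto_limit[OF elim P0] limit_psd[OF elim]])
          (intro always_eventually allI backward_psd P0)
      then show ?case by (simp add: psd_limit_eq elim)
    qed
  qed
  then show "(\<lambda>t. integral\<^sup>L (distr coins psd_borel (\<lambda>s. backward t s P0)) h) \<longlonglongrightarrow> integral\<^sup>L stationary h"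
    unfolding stationary_def
    by (simp add: integral_distr[OF measurable_backward[OF P0] hm] integral_distr[OF measurable_psd_limit hm])
qed

section \<open>Lower bound and support of the invariant distribution\<close>

lemma stationary_ge_P_star: "measure stationary {Y \<in> psd_cone. P_star \<preceq> Y} = 1"
proof -
  have B: "{Y \<in> psd_cone. P_star \<preceq> Y} \<in> sets psd_borel"
    unfolding sets_psd_borel_iff by (auto intro: borel_closed closed_loewner_ge P_star_psd)
  have "AE s in coins. s \<in> {s. psd_limit s \<in> {Y \<in> psd_cone. P_star \<preceq> Y}}"
    using AE_regenerative
    by eventually_elim (simp add: psd_limit_eq limit_psd P_star_le_limit)
  then have "emeasure coins {s. psd_limit s \<in> {Y \<in> psd_cone. P_star \<preceq> Y}} = 1"
    by (rule coins.emeasure_eq_1_AE[OF sets_psd_limit[OF B]])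
  then show ?thesis by (simp add: measure_def emeasure_stationary[OF B])
qed

lemma psd_mball_open:
  obtains T where "open T" "psd.mball X r = psd_cone \<inter> T"
proof -
  have "openin (top_of_set psd_cone) (psd.mball X r)"
    using psd.openin_mball[of X r] by (simp add: psd_mtopology)
  then show thesis using that unfolding openin_open by blast
qed

lemma measure_stationary_pos_iff:
  assumes "B \<in> sets psd_borel"
  shows "0 < measure stationary B \<longleftrightarrow> \<not> (AE s in coins. psd_limit s \<notin> B)"
proof -
  have "(AE s in coins. psd_limit s \<notin> B) \<longleftrightarrow> emeasure coins {s. psd_limit s \<in> B} = 0"
    using AE_iff_measurable[OF sets_psd_limit[OF assms], of "\<lambda>s. psd_limit s \<notin> B"] by (simp add: space_coins)
  also have "\<dots> \<longleftrightarrow> measure stationary B = 0"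
    by (simp add: measure_def emeasure_stationary[OF assms] enn2real_eq_0_iff coins.emeasure_finite)
  finally show ?thesis using measure_nonneg[of stationary B] by linarith
qed

lemma support_stationary:
  assumes "g < 1"
  shows "psd_support stationary = psd.mtopology closure_of riccati_orbit A C Q R"
proof (intro equalityI subsetI)
  fix X assume "X \<in> psd_support stationary"
  then have X: "X \<in> psd_cone" and pos: "\<And>r. r > 0 \<Longrightarrow> 0 < measure stationary (psd.mball X r)"
    by (auto simp: psd_support_def)
  show "X \<in> psd.mtopology closure_of riccati_orbit A C Q R"
    unfolding psd.metric_closure_of
  proof (intro CollectI conjI X allI impI)
    fix r :: real assume "r > 0"
    obtain T where T: "open T" "psd.mball X r = psd_cone \<inter> T" by (rule psd_mball_open)
    then have "psd.mball X r \<in> sets psd_borel"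
      by (simp add: sets_psd_borel_iff borel_closed closed_psd_cone)
    then have "\<not> (AE s in coins. psd_limit s \<notin> psd.mball X r)"
      using pos[OF \<open>r > 0\<close>] measure_stationary_pos_iff by blast
    \<comment> \<open>A ball of positive measure is hit by the limit of some regenerative stream;
      cutting this stream off and inserting \<open>P_star\<close> gives the orbit point.\<close>
    moreover have "AE s in coins. psd_limit s \<notin> psd.mball X r"
      if "\<And>s. regenerative s \<Longrightarrow> limit s \<notin> T"
      using AE_regenerative by eventually_elim (simp add: T(2) psd_limit_eq that)
    ultimately obtain s where s: "regenerative s" "limit s \<in> T" by blast
    obtain n where "\<forall>X\<in>psd_cone. backward n s X \<in> T"
      using backward_eventually_in_open[OF s(1) T(1) s(2)] unfolding eventually_sequentially by blast
    then have "backward n s P_star \<in> psd.mball X r"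
      unfolding T(2) using P_star_psd backward_psd by blast
    moreover have "backward n s P_star \<in> riccati_orbit A C Q R"
      unfolding riccati_orbit_def backward_def by blast
    ultimately show "\<exists>Y\<in>riccati_orbit A C Q R. Y \<in> psd.mball X r" by blast
  qed
next
  fix X assume "X \<in> psd.mtopology closure_of riccati_orbit A C Q R"
  then have X: "X \<in> psd_cone" and near: "\<And>r. r > 0 \<Longrightarrow> \<exists>Y\<in>riccati_orbit A C Q R. Y \<in> psd.mball X r"
    by (auto simp: psd.metric_closure_of)
  have "0 < measure stationary (psd.mball X r)" if "r > 0" for r
  proof -
    obtain T where T: "open T" "psd.mball X r = psd_cone \<inter> T" by (rule psd_mball_open)
    then have ball: "psd.mball X r \<in> sets psd_borel"
      by (simp add: sets_psd_borel_iff borel_closed closed_psd_cone)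
    obtain w where w: "foldr f w P_star \<in> T"
      using near[OF \<open>r > 0\<close>] T(2) unfolding riccati_orbit_def by blast
    \<comment> \<open>After the word only arrivals follow, so the limit of \<open>S\<close> is the
      orbit point \<open>foldr f w P_star\<close>.\<close>
    define S where "S = w @- sconst True"
    have S: "sdrop (length w) S = sconst True" "stake (length w) S = w"
      by (simp_all add: S_def stake_shift sdrop_shift)
    have reg: "regenerative S"
      by (rule regenerative_sdropD[of "length w"]) (simp only: S(1) regenerative_sconst)
    have "limit S \<in> T"
      using limit_eq_backward[OF reg, of "length w"] w unfolding S(1) backward_def S(2)
      by (simp add: P_star_eq_limit)
    \<comment> \<open>From here on the first \<open>n\<close> coins alone force the limit into
      \<open>T\<close>, and this prefix has positive probability because losses and arrivals both
      do.\<close>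
    then obtain n where n: "\<And>X. X \<in> psd_cone \<Longrightarrow> backward n S X \<in> T"
      using backward_eventually_in_open[OF reg T(1)] unfolding eventually_sequentially by blast
    have "\<not> (AE s in coins. psd_limit s \<notin> psd.mball X r)"
    proof
      assume "AE s in coins. psd_limit s \<notin> psd.mball X r"
      then have "AE s in coins. stake n s \<noteq> stake n S"
        using AE_regenerative
      proof eventually_elim
        case (elim s)
        show ?case
        proof
          assume "stake n s = stake n S"
          then have "limit s = backward n S (limit (sdrop n s))"
            using limit_eq_backward[OF elim(2), of n] by (simp add: backward_def)
          then have "limit s \<in> T" using n limit_psd regenerative_sdrop[OF elim(2)] by simp
          then show False using elim by (simp add: T(2) psd_limit_eq limit_psd)
        qed
      qed
      then have "emeasure coins {s. stake n s = stake n S} = 0"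
        using AE_iff_measurable[OF pred_stake_coins, of "\<lambda>s. stake n s \<noteq> stake n S" n "stake n S"]
        by (simp add: space_coins)
      moreover have "word_prob (stake n S) > 0" by (rule word_prob_pos[OF \<open>g < 1\<close>])
      ultimately show False
        using emeasure_stake[of "stake n S"] by (simp add: order_less_le)
    qed
    then show ?thesis using measure_stationary_pos_iff[OF ball] by blast
  qed
  then show "X \<in> psd_support stationary" using X by (simp add: psd_support_def)
qed

text \<open>The given process applies the newest coin outermost, so it corresponds to the reversed
  word. Both words have the same law, because the probability of a word is a product and reversal
  does not change it.\<close>

lemma distr_riccati_seq:
  fixes \<Omega> :: "'w measure" and \<gamma> :: "nat \<Rightarrow> 'w \<Rightarrow> bool"
  assumes "prob_space \<Omega>" and indep: "prob_space.indep_vars \<Omega> (\<lambda>_. count_space UNIV) \<gamma> UNIV"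
    and prob: "\<And>t. measure \<Omega> {\<omega> \<in> space \<Omega>. \<gamma> t \<omega> = True} = g"
    and P0: "P0 \<in> psd_cone"
  shows "distr \<Omega> psd_borel (riccati_seq A C Q R \<gamma> P0 t) = distr coins psd_borel (\<lambda>s. backward t s P0)"
proof -
  interpret \<Omega>: prob_space \<Omega> by fact
  define past where "past = (\<lambda>\<omega>. rev (map (\<lambda>i. \<gamma> i \<omega>) [0..<t]))"
  have seq: "riccati_seq A C Q R \<gamma> P0 t \<omega> = foldr f (past \<omega>) P0" for \<omega>
    unfolding past_def by (induction t) simp_all
  have \<gamma>: "\<gamma> i \<in> \<Omega> \<rightarrow>\<^sub>M count_space UNIV" for i
    using indep unfolding \<Omega>.indep_vars_def by blast
  have past_eq: "past \<omega> = w \<longleftrightarrow> length w = t \<and> (\<forall>i<t. \<gamma> i \<omega> = rev w ! i)" for \<omega> w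
  proof -
    have "past \<omega> = w \<longleftrightarrow> map (\<lambda>i. \<gamma> i \<omega>) [0..<t] = rev w"
      unfolding past_def by (rule rev_swap)
    also have "\<dots> \<longleftrightarrow> t = length w \<and> (\<forall>i<t. \<gamma> i \<omega> = rev w ! i)"
      by (simp add: list_eq_iff_nth_eq)
    finally show ?thesis by (simp only: eq_commute[of t])
  qed
  have coin_prob: "measure \<Omega> (\<gamma> i -` {b} \<inter> space \<Omega>) = pmf (bernoulli_pmf g) b" for i b
  proof -
    have T: "measure \<Omega> (\<gamma> i -` {True} \<inter> space \<Omega>) = g"
      using prob[of i] by (simp add: vimage_def Int_def conj_commute)
    have "\<gamma> i -` {False} \<inter> space \<Omega> = space \<Omega> - (\<gamma> i -` {True} \<inter> space \<Omega>)" by auto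
    then have "measure \<Omega> (\<gamma> i -` {False} \<inter> space \<Omega>) = 1 - g"
      using \<Omega>.prob_compl[OF measurable_sets[OF \<gamma>, of "{True}" i]] T by simp
    then show ?thesis using T g_pos g_le_1 by (cases b) simp_all
  qed
  have event: "past -` {w} \<inter> space \<Omega> = (if length w = t then {\<omega> \<in> space \<Omega>. \<forall>i<t. \<gamma> i \<omega> = rev w ! i} else {})" for w
    using past_eq[of _ w] by (cases "length w = t") (simp_all add: vimage_def Int_def conj_commute)
  have set: "{\<omega> \<in> space \<Omega>. \<forall>i<t. \<gamma> i \<omega> = b i} \<in> sets \<Omega>" for b
  proof -
    have "{\<omega> \<in> space \<Omega>. \<gamma> i \<omega> = b i} \<in> sets \<Omega>" for i
      using measurable_sets[OF \<gamma>, of "{b i}" i] by (simp add: vimage_def Int_def conj_commute)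
    then have "{\<omega> \<in> space \<Omega>. \<forall>i\<in>{..<t}. \<gamma> i \<omega> = b i} \<in> sets \<Omega>"
      by (rule sets.sets_Collect_finite_All) simp
    then show ?thesis unfolding Ball_def lessThan_iff .
  qed
  have preimage: "past -` {w} \<inter> space \<Omega> \<in> sets \<Omega>" for w
  proof (cases "length w = t")
    case True
    show ?thesis unfolding event if_P[OF True] by (rule set)
  next
    case False
    show ?thesis unfolding event if_not_P[OF False] by (rule sets.empty_sets)
  qed
  have past: "past \<in> \<Omega> \<rightarrow>\<^sub>M count_space UNIV"
    by (rule measurable_count_space_eq_countable[THEN iffD2]) (simp_all only: preimage countableI_type UNIV_I Pi_UNIV simp_thms ball_UNIV)
  \<comment> \<open>Words form a countable type, so equality of the two laws reduces to
    singletons.\<close>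
  have "emeasure (distr \<Omega> (count_space UNIV) past) {w} = emeasure (distr coins (count_space UNIV) (stake t)) {w}" for w
  proof (cases "length w = t")
    case False
    then have "past -` {w} \<inter> space \<Omega> = {}" "stake t -` {w} \<inter> space coins = {}"
      by (auto simp: event)
    then show ?thesis by (simp add: emeasure_distr past)
  next
    case True
    have "measure \<Omega> {\<omega> \<in> space \<Omega>. \<forall>i<t. \<gamma> i \<omega> = rev w ! i} = (\<Prod>i<t. pmf (bernoulli_pmf g) (rev w ! i))"
    \<comment> \<open>For \<open>t = 0\<close> the intersection over \<open>{..<t}\<close> would be
      the whole type instead of \<open>space \<Omega>\<close>.\<close>
    proof (cases "t = 0")
      case False
      have "{\<omega> \<in> space \<Omega>. \<forall>i<t. \<gamma> i \<omega> = rev w ! i} = (\<Inter>i\<in>{..<t}. \<gamma> i -` {rev w ! i} \<inter> space \<Omega>)"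
        using False by auto
      then show ?thesis
        using \<Omega>.indep_varsD[OF indep, of "{..<t}" "\<lambda>i. {rev w ! i}"] False
        by (simp add: coin_prob lessThan_empty_iff)
    qed (simp add: \<Omega>.prob_space)
    also have "\<dots> = prod_list (map (pmf (bernoulli_pmf g)) (rev w))"
      using True by (simp add: prod_list_eq_prod_nth)
    also have "\<dots> = word_prob w"
      by (simp add: word_prob_def prod_list.rev flip: rev_map)
    finally have "emeasure \<Omega> (past -` {w} \<inter> space \<Omega>) = word_prob w"
      using True by (simp add: event \<Omega>.emeasure_eq_measure)
    then show ?thesis
      using emeasure_stake[of w] True by (simp add: emeasure_distr past space_coins vimage_def)
  qed
  then have "distr \<Omega> (count_space UNIV) past = distr coins (count_space UNIV) (stake t)"
    by (intro measure_eqI_countable[where A = UNIV]) auto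
  moreover have meas: "(\<lambda>w. foldr f w P0) \<in> count_space UNIV \<rightarrow>\<^sub>M psd_borel"
    by (auto simp: space_psd_borel intro: foldr_psd P0)
  ultimately have "distr \<Omega> psd_borel ((\<lambda>w. foldr f w P0) \<circ> past) = distr coins psd_borel ((\<lambda>w. foldr f w P0) \<circ> stake t)"
    by (simp only: distr_distr[OF meas past, symmetric] distr_distr[OF meas measurable_stake_coins, symmetric])
  moreover have "riccati_seq A C Q R \<gamma> P0 t = (\<lambda>w. foldr f w P0) \<circ> past"
    by (simp only: fun_eq_iff o_def seq simp_thms)
  moreover have "(\<lambda>s. backward t s P0) = (\<lambda>w. foldr f w P0) \<circ> stake t"
    by (simp only: fun_eq_iff o_def backward_def simp_thms)
  ultimately show ?thesis by (simp only:)
qed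

end

theorem mainTheorem1:
  fixes A Q :: "real^'n^'n" and C :: "real^'n^'m" and R :: "real^'m^'m"
    and \<Omega> :: "'w measure" and \<gamma> :: "nat \<Rightarrow> 'w \<Rightarrow> bool" and g :: real
  assumes "observable C A" and "pos_def Q" and "pos_def R"
    and "0 < g" and "g \<le> 1"
    and "prob_space \<Omega>"
    and "prob_space.indep_vars \<Omega> (\<lambda>_. count_space UNIV) \<gamma> UNIV"
    and "\<And>t. measure \<Omega> {\<omega> \<in> space \<Omega>. \<gamma> t \<omega> = True} = g"
  shows "\<exists>\<mu>. riccati_invariant A C Q R g \<mu>
    \<and> (\<forall>\<nu>. riccati_invariant A C Q R g \<nu> \<longrightarrow> \<nu> = \<mu>)
    \<and> (\<forall>P0\<in>psd_cone. psd_weak_conv (\<lambda>t. distr \<Omega> psd_borel (riccati_seq A C Q R \<gamma> P0 t)) \<mu>)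
    \<and> (g < 1 \<longrightarrow>
         psd_support \<mu> = psd.mtopology closure_of riccati_orbit A C Q R
         \<and> measure \<mu> {Y \<in> psd_cone. riccati_fixpoint A C Q R \<preceq> Y} = 1)"
proof -
  interpret riccati_random A Q C R g
    using assms(1-5) by unfold_locales
  show ?thesis
  proof (intro exI[of _ stationary] conjI allI ballI impI)
    fix P0 :: "real^'n^'n" assume P0: "P0 \<in> psd_cone"
    show "psd_weak_conv (\<lambda>t. distr \<Omega> psd_borel (riccati_seq A C Q R \<gamma> P0 t)) stationary"
      using weak_conv_backward[OF P0] unfolding distr_riccati_seq[OF assms(6-8) P0] .
  qed (use riccati_invariant_stationary invariant_unique support_stationary stationary_ge_P_star in blast)+
qed

end
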